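(* Let $1\le s\le r$ be integers. Suppose $\mathbb{Z}_2$ acts freely on a compact Hausdorff space $X$ with $X\simeq_2\mathbb{C}H_{r,s}$ and on a path-connected compact Hausdorff space $Y$ such that $H^2(Y/\mathbb{Z}_2;\mathbb{Z}_2)=0$. Then there is no $\mathbb{Z}_2$-equivariant map $X\to Y$.
   Context: For integers $0\le s\le r$, the complex Milnor manifold is $$\mathbb{C}H_{r,s}=\{([z_0,\dots,z_r],[w_0,\dots,w_s])\in\mathbb{C}P^r\times\mathbb{C}P^s : z_0\overline{w}_0+\cdots+z_s\overline{w}_s=0\}.$$ For spaces $X$ and $Y$, $X\simeq_2 Y$ means that the graded algebras $H^*(X;\mathbb{Z}_2)$ and $H^*(Y;\mathbb{Z}_2)$ are isomorphic (not necessarily via a map between $X$ and $Y$). Equivariant maps are continuous. *)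

theory Defs
  imports "HOL-Homology.Homology" "HOL-Algebra.Group_Action" "HOL-Library.Z2"
begin

section \<open>Quotient topology\<close>

definition quotient_topology :: "'a topology \<Rightarrow> ('a \<Rightarrow> 'b) \<Rightarrow> 'b topology" where
  "quotient_topology X q =
     topology (\<lambda>U. U \<subseteq> q ` topspace X \<and> openin X {x \<in> topspace X. q x \<in> U})"

lemma openin_quotient_topology:
  "openin (quotient_topology X q) U \<longleftrightarrow>
     U \<subseteq> q ` topspace X \<and> openin X {x \<in> topspace X. q x \<in> U}"
proof -
  have "istopology (\<lambda>U. U \<subseteq> q ` topspace X \<and> openin X {x \<in> topspace X. q x \<in> U})"
    unfolding istopology_def
  proof (rule conjI; clarify)
    fix S T
    assume S: "S \<subseteq> q ` topspace X" "openin X {x \<in> topspace X. q x \<in> S}"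
      and T: "T \<subseteq> q ` topspace X" "openin X {x \<in> topspace X. q x \<in> T}"
    have "{x \<in> topspace X. q x \<in> S \<inter> T} =
          {x \<in> topspace X. q x \<in> S} \<inter> {x \<in> topspace X. q x \<in> T}"
      by auto
    with S T show "S \<inter> T \<subseteq> q ` topspace X \<and> openin X {x \<in> topspace X. q x \<in> S \<inter> T}"
      by auto
  next
    fix \<K>
    assume K: "\<forall>K\<in>\<K>. K \<subseteq> q ` topspace X \<and> openin X {x \<in> topspace X. q x \<in> K}"
    have "{x \<in> topspace X. q x \<in> \<Union>\<K>} = (\<Union>K\<in>\<K>. {x \<in> topspace X. q x \<in> K})"
      by auto
    moreover have "openin X (\<Union>K\<in>\<K>. {x \<in> topspace X. q x \<in> K})"
      using K by (intro openin_Union) auto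
    moreover have "\<Union>\<K> \<subseteq> q ` topspace X"
      using K by blast
    ultimately show "\<Union>\<K> \<subseteq> q ` topspace X \<and> openin X {x \<in> topspace X. q x \<in> \<Union>\<K>}"
      by simp
  qed
  then show ?thesis
    by (simp add: quotient_topology_def topology_inverse')
qed

lemma topspace_quotient_topology [simp]: "topspace (quotient_topology X q) = q ` topspace X"
proof (rule subset_antisym)
  show "topspace (quotient_topology X q) \<subseteq> q ` topspace X"
    by (metis openin_quotient_topology openin_topspace)
  have "{x \<in> topspace X. q x \<in> q ` topspace X} = topspace X"
    by auto
  then show "q ` topspace X \<subseteq> topspace (quotient_topology X q)"
    by (intro openin_subset) (simp add: openin_quotient_topology)
qed

lemma quotient_map_quotient_topology: "quotient_map X (quotient_topology X q) q"
  by (simp add: quotient_map_def openin_quotient_topology)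

section \<open>Complex Milnor manifolds\<close>

text \<open>As in \<^const>\<open>nsphere\<close>, a vector with coordinates \<open>z\<^sub>0, \<dots>, z\<^sub>n\<close> is a sequence vanishing
  beyond \<open>n\<close>. A point of projective space is a line through the origin with the origin removed.\<close>

definition complex_nonzero :: "nat \<Rightarrow> (nat \<Rightarrow> complex) set" where
  "complex_nonzero n = {z. (\<forall>i>n. z i = 0) \<and> (\<exists>i\<le>n. z i \<noteq> 0)}"

definition complex_line :: "(nat \<Rightarrow> complex) \<Rightarrow> (nat \<Rightarrow> complex) set" where
  "complex_line z = {(\<lambda>i. c * z i) | c. c \<noteq> 0}"

definition complex_projective_space :: "nat \<Rightarrow> (nat \<Rightarrow> complex) set topology" where
  "complex_projective_space n =
     quotient_topology
       (subtopology (product_topology (\<lambda>_. euclidean) UNIV) (complex_nonzero n)) complex_line"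

definition complex_Milnor ::
    "nat \<Rightarrow> nat \<Rightarrow> ((nat \<Rightarrow> complex) set \<times> (nat \<Rightarrow> complex) set) topology" where
  "complex_Milnor r s =
     subtopology (prod_topology (complex_projective_space r) (complex_projective_space s))
       {(complex_line z, complex_line w) | z w.
          z \<in> complex_nonzero r \<and> w \<in> complex_nonzero s \<and> (\<Sum>i\<le>s. z i * cnj (w i)) = 0}"

section \<open>Singular cohomology with coefficients in the field of two elements\<close>

declare add_bit_eq_xor [simp del] mult_bit_eq_and [simp del]

text \<open>Cochains are functions on singular simplices, made canonical by the value 0 elsewhere.
  Modulo 2 no signs are needed, and additive maps are linear.\<close>

definition cochain_group :: "nat \<Rightarrow> 'a topology \<Rightarrow> (((nat \<Rightarrow> real) \<Rightarrow> 'a) \<Rightarrow> bit) monoid" where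
  "cochain_group p X =
     \<lparr>carrier = {c. \<forall>f. \<not> singular_simplex p X f \<longrightarrow> c f = 0},
      monoid.mult = (\<lambda>a b f. a f + b f), one = (\<lambda>_. 0)\<rparr>"

definition coboundary ::
    "nat \<Rightarrow> 'a topology \<Rightarrow> (((nat \<Rightarrow> real) \<Rightarrow> 'a) \<Rightarrow> bit) \<Rightarrow> ((nat \<Rightarrow> real) \<Rightarrow> 'a) \<Rightarrow> bit" where
  "coboundary p X c f =
     (if singular_simplex (Suc p) X f then \<Sum>k\<le>Suc p. c (singular_face (Suc p) k f) else 0)"

definition cocycles :: "nat \<Rightarrow> 'a topology \<Rightarrow> (((nat \<Rightarrow> real) \<Rightarrow> 'a) \<Rightarrow> bit) set" where
  "cocycles p X = {c \<in> carrier (cochain_group p X). coboundary p X c = (\<lambda>_. 0)}"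

fun coboundaries :: "nat \<Rightarrow> 'a topology \<Rightarrow> (((nat \<Rightarrow> real) \<Rightarrow> 'a) \<Rightarrow> bit) set" where
  "coboundaries 0 X = {\<lambda>_. 0}"
| "coboundaries (Suc p) X = coboundary p X ` carrier (cochain_group p X)"

definition cohomology_group ::
    "nat \<Rightarrow> 'a topology \<Rightarrow> (((nat \<Rightarrow> real) \<Rightarrow> 'a) \<Rightarrow> bit) set monoid" where
  "cohomology_group p X = (cochain_group p X)\<lparr>carrier := cocycles p X\<rparr> Mod coboundaries p X"

text \<open>The restrictions of a singular simplex to its first \<open>p + 1\<close> vertices and to the \<open>q + 1\<close>
  vertices starting with vertex \<open>p\<close>.\<close>

definition front_face :: "nat \<Rightarrow> ((nat \<Rightarrow> real) \<Rightarrow> 'a) \<Rightarrow> (nat \<Rightarrow> real) \<Rightarrow> 'a" where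
  "front_face p f = restrict f (standard_simplex p)"

definition back_face :: "nat \<Rightarrow> nat \<Rightarrow> ((nat \<Rightarrow> real) \<Rightarrow> 'a) \<Rightarrow> (nat \<Rightarrow> real) \<Rightarrow> 'a" where
  "back_face p q f = restrict (\<lambda>x. f (\<lambda>i. if i < p then 0 else x (i - p))) (standard_simplex q)"

definition cochain_cup :: "nat \<Rightarrow> nat \<Rightarrow> 'a topology \<Rightarrow> (((nat \<Rightarrow> real) \<Rightarrow> 'a) \<Rightarrow> bit) \<Rightarrow>
    (((nat \<Rightarrow> real) \<Rightarrow> 'a) \<Rightarrow> bit) \<Rightarrow> ((nat \<Rightarrow> real) \<Rightarrow> 'a) \<Rightarrow> bit" where
  "cochain_cup p q X a b f =
     (if singular_simplex (p + q) X f then a (front_face p f) * b (back_face p q f) else 0)"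

definition cochain_unit :: "'a topology \<Rightarrow> ((nat \<Rightarrow> real) \<Rightarrow> 'a) \<Rightarrow> bit" where
  "cochain_unit X f = (if singular_simplex 0 X f then 1 else 0)"

text \<open>The union below is a single coset; see \<open>cup_product_coset\<close>.\<close>

definition cup_product :: "nat \<Rightarrow> nat \<Rightarrow> 'a topology \<Rightarrow> (((nat \<Rightarrow> real) \<Rightarrow> 'a) \<Rightarrow> bit) set \<Rightarrow>
    (((nat \<Rightarrow> real) \<Rightarrow> 'a) \<Rightarrow> bit) set \<Rightarrow> (((nat \<Rightarrow> real) \<Rightarrow> 'a) \<Rightarrow> bit) set" where
  "cup_product p q X A B =
     (\<Union>a\<in>A. \<Union>b\<in>B. coboundaries (p + q) X #>\<^bsub>cochain_group (p + q) X\<^esub> cochain_cup p q X a b)"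

definition cohomology_unit :: "'a topology \<Rightarrow> (((nat \<Rightarrow> real) \<Rightarrow> 'a) \<Rightarrow> bit) set" where
  "cohomology_unit X = coboundaries 0 X #>\<^bsub>cochain_group 0 X\<^esub> cochain_unit X"

text \<open>Isomorphism of the graded unital cohomology algebras.\<close>

definition cohomology_algebras_isomorphic ::
    "'a topology \<Rightarrow> 'b topology \<Rightarrow> bool"  (infix "\<simeq>\<^sub>2" 50) where
  "X \<simeq>\<^sub>2 Y \<longleftrightarrow>
     (\<exists>h. (\<forall>p. h p \<in> iso (cohomology_group p X) (cohomology_group p Y)) \<and>
          (\<forall>p q. \<forall>a \<in> carrier (cohomology_group p X). \<forall>b \<in> carrier (cohomology_group q X).
             h (p + q) (cup_product p q X a b) = cup_product p q Y (h p a) (h q b)) \<and>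
          h 0 (cohomology_unit X) = cohomology_unit Y)"

subsection \<open>Cohomology groups and their cup product are well defined\<close>

lemma carrier_cochain_group:
  "c \<in> carrier (cochain_group p X) \<longleftrightarrow> (\<forall>f. \<not> singular_simplex p X f \<longrightarrow> c f = 0)"
  by (simp add: cochain_group_def)

lemma mult_cochain_group [simp]: "a \<otimes>\<^bsub>cochain_group p X\<^esub> b = (\<lambda>f. a f + b f)"
  by (simp add: cochain_group_def)

lemma one_cochain_group [simp]: "\<one>\<^bsub>cochain_group p X\<^esub> = (\<lambda>_. 0)"
  by (simp add: cochain_group_def)

lemma bit_add_self: "x + x = (0::bit)"
  by (cases x) auto

lemma comm_group_cochain_group: "comm_group (cochain_group p X)"
proof (rule comm_groupI)
  fix c assume "c \<in> carrier (cochain_group p X)"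
  then show "\<exists>d \<in> carrier (cochain_group p X). d \<otimes>\<^bsub>cochain_group p X\<^esub> c = \<one>\<^bsub>cochain_group p X\<^esub>"
    by (intro bexI[of _ c]) (simp_all add: bit_add_self)
qed (auto simp: carrier_cochain_group add_ac)

lemma group_cochain_group: "group (cochain_group p X)"
  using comm_group_cochain_group comm_group.axioms(2) by blast

lemma inv_cochain_group:
  assumes "c \<in> carrier (cochain_group p X)"
  shows "inv\<^bsub>cochain_group p X\<^esub> c = c"
  using assms group_cochain_group[of p X]
  by (intro group.inv_equality) (simp_all add: bit_add_self)

lemma coboundary_in_carrier: "coboundary p X c \<in> carrier (cochain_group (Suc p) X)"
  by (simp add: carrier_cochain_group coboundary_def)

lemma coboundary_add:
  "coboundary p X (\<lambda>f. a f + b f) = (\<lambda>f. coboundary p X a f + coboundary p X b f)"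
  by (simp add: coboundary_def fun_eq_iff sum.distrib)

lemma coboundary_zero [simp]: "coboundary p X (\<lambda>_. 0) = (\<lambda>_. 0)"
  by (simp add: coboundary_def fun_eq_iff)

lemma singular_face_singular_face:
  assumes "i \<le> j" "j \<le> Suc p"
  shows "singular_face (Suc p) i (singular_face (Suc (Suc p)) (Suc j) f) =
         singular_face (Suc p) j (singular_face (Suc (Suc p)) i f)"
proof
  fix t
  show "singular_face (Suc p) i (singular_face (Suc (Suc p)) (Suc j) f) t =
        singular_face (Suc p) j (singular_face (Suc (Suc p)) i f) t"
  proof (cases "t \<in> standard_simplex p")
    case True
    have "simplical_face i t \<in> standard_simplex (Suc p)" "simplical_face j t \<in> standard_simplex (Suc p)"
      using True assms simplical_face_in_standard_simplex[of "Suc p" _ t] by auto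
    moreover have "simplical_face (Suc j) (simplical_face i t) = simplical_face i (simplical_face j t)"
      using assms unfolding simplical_face_def by fastforce
    ultimately show ?thesis
      by (simp add: singular_face_def)
  qed (simp add: singular_face_def)
qed

lemma coboundary_coboundary: "coboundary (Suc p) X (coboundary p X c) = (\<lambda>_. 0)"
proof
  fix f
  show "coboundary (Suc p) X (coboundary p X c) f = 0"
  proof (cases "singular_simplex (Suc (Suc p)) X f")
    case True
    let ?c = "\<lambda>(k, i). c (singular_face (Suc p) i (singular_face (Suc (Suc p)) k f))"
    let ?U = "{..Suc (Suc p)} \<times> {..Suc p}"
    let ?L = "{(i, j). i \<le> j \<and> j \<le> Suc p}"
    have eql: "?U \<inter> {(k, i). i < k} = (\<lambda>(j, i). (Suc i, j)) ` ?L"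
    proof (rule subset_antisym; clarify)
      fix k i assume "(k::nat) \<le> Suc (Suc p)" "i \<le> Suc p" "i < k"
      then show "(k, i) \<in> (\<lambda>(j, i). (Suc i, j)) ` ?L"
        by (intro image_eqI[of _ _ "(i, k - 1)"]) auto
    qed auto
    have eqr: "?U - {(k, i). i < k} = ?L"
      by auto
    have "singular_simplex (Suc p) X (singular_face (Suc (Suc p)) k f)" if "k \<le> Suc (Suc p)" for k
      using singular_simplex_singular_face[OF True, of k] that by simp
    then have "coboundary (Suc p) X (coboundary p X c) f =
               (\<Sum>k\<le>Suc (Suc p). \<Sum>i\<le>Suc p. ?c (k, i))"
      using True by (simp add: coboundary_def del: sum.atMost_Suc)
    also have "\<dots> = sum ?c ?U"
      by (simp add: sum.cartesian_product del: sum.atMost_Suc)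
    also have "\<dots> = sum ?c (?U \<inter> {(k, i). i < k}) + sum ?c (?U - {(k, i). i < k})"
      by (rule sum.Int_Diff) simp
    also have "sum ?c (?U \<inter> {(k, i). i < k}) = sum ?c ?L"
      unfolding eql by (subst sum.reindex) (auto simp: inj_on_def singular_face_singular_face intro!: sum.cong)
    also have "sum ?c ?L + sum ?c (?U - {(k, i). i < k}) = 0"
      unfolding eqr by (rule bit_add_self)
    finally show ?thesis .
  qed (simp add: coboundary_def)
qed

lemma coboundaries_subset_cocycles: "coboundaries p X \<subseteq> cocycles p X"
proof (cases p)
  case 0
  then show ?thesis
    by (simp add: cocycles_def carrier_cochain_group)
next
  case (Suc n)
  then show ?thesis
    by (auto simp: cocycles_def coboundary_in_carrier coboundary_coboundary)
qed

lemma subgroup_cocycles: "subgroup (cocycles p X) (cochain_group p X)"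
proof (rule group.subgroupI[OF group_cochain_group])
  have "(\<lambda>_. 0) \<in> cocycles p X"
    by (simp add: cocycles_def carrier_cochain_group)
  then show "cocycles p X \<noteq> {}"
    by blast
qed (auto simp: cocycles_def inv_cochain_group coboundary_add carrier_cochain_group)

lemma zero_in_coboundaries: "(\<lambda>_. 0) \<in> coboundaries p X"
  by (cases p) (auto intro!: image_eqI[of _ _ "\<lambda>_. 0"] simp: carrier_cochain_group)

lemma add_in_coboundaries:
  assumes "a \<in> coboundaries p X" "b \<in> coboundaries p X"
  shows "(\<lambda>f. a f + b f) \<in> coboundaries p X"
proof (cases p)
  case (Suc q)
  with assms obtain c d where "c \<in> carrier (cochain_group q X)" "d \<in> carrier (cochain_group q X)"
      "a = coboundary q X c" "b = coboundary q X d"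
    by auto
  then show ?thesis
    unfolding Suc by (auto intro!: image_eqI[of _ _ "\<lambda>f. c f + d f"]
        simp: coboundary_add carrier_cochain_group)
qed (use assms in auto)

lemma subgroup_coboundaries: "subgroup (coboundaries p X) (cochain_group p X)"
proof (rule group.subgroupI[OF group_cochain_group])
  show sub: "coboundaries p X \<subseteq> carrier (cochain_group p X)"
    using coboundaries_subset_cocycles by (auto simp: cocycles_def)
  show "coboundaries p X \<noteq> {}"
    using zero_in_coboundaries by blast
  show "inv\<^bsub>cochain_group p X\<^esub> a \<in> coboundaries p X" if "a \<in> coboundaries p X" for a
    using that sub by (metis inv_cochain_group subsetD)
qed (simp add: add_in_coboundaries)

lemma comm_group_cohomology_group: "comm_group (cohomology_group p X)"
proof -
  have "comm_group ((cochain_group p X)\<lparr>carrier := cocycles p X\<rparr>)"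
  proof (rule group.group_comm_groupI)
    show "group ((cochain_group p X)\<lparr>carrier := cocycles p X\<rparr>)"
      by (rule subgroup.subgroup_is_group[OF subgroup_cocycles group_cochain_group])
  qed (simp add: add.commute)
  moreover have "subgroup (coboundaries p X) ((cochain_group p X)\<lparr>carrier := cocycles p X\<rparr>)"
    by (simp add: group.subgroup_incl group_cochain_group subgroup_coboundaries subgroup_cocycles
        coboundaries_subset_cocycles)
  ultimately show ?thesis
    unfolding cohomology_group_def by (rule comm_group.abelian_FactGroup)
qed

lemma carrier_cohomology_group:
  "carrier (cohomology_group p X) =
     {coboundaries p X #>\<^bsub>cochain_group p X\<^esub> a | a. a \<in> cocycles p X}"
  by (auto simp: cohomology_group_def FactGroup_def RCOSETS_def r_coset_def)

lemma front_face_singular_simplex: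
  assumes "singular_simplex (p + q) X f"
  shows "singular_simplex p X (front_face p f)"
proof -
  have "continuous_map (subtopology (powertop_real UNIV) (standard_simplex p)) X f"
    using assms continuous_map_from_subtopology_mono standard_simplex_mono[of p "p + q"]
    unfolding singular_simplex_def by fastforce
  then show ?thesis
    unfolding singular_simplex_def front_face_def
    by (auto elim!: continuous_map_eq)
qed

lemma shift_in_standard_simplex:
  assumes "x \<in> standard_simplex q"
  shows "(\<lambda>i. if i < p then 0 else x (i - p)) \<in> standard_simplex (p + q)"
proof -
  have "(\<Sum>i\<le>p + q. if i < p then 0 else x (i - p)) = (\<Sum>i\<in>{p..p + q}. x (i - p))"
    by (rule sum.mono_neutral_cong_right) auto
  also have "\<dots> = (\<Sum>i\<le>q. x i)"
    by (rule sum.reindex_bij_witness[of _ "\<lambda>i. i + p" "\<lambda>i. i - p"]) auto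
  finally show ?thesis
    using assms by (auto simp: standard_simplex_def)
qed

lemma back_face_singular_simplex:
  assumes "singular_simplex (p + q) X f"
  shows "singular_simplex q X (back_face p q f)"
proof -
  let ?h = "\<lambda>x. (\<lambda>i. if i < p then 0 else x (i - p)) :: nat \<Rightarrow> real"
  have "continuous_map (powertop_real UNIV) euclideanreal (\<lambda>x. ?h x i)" for i
    by (auto intro: continuous_map_product_projection)
  then have "continuous_map (subtopology (powertop_real UNIV) (standard_simplex q))
        (subtopology (powertop_real UNIV) (standard_simplex (p + q))) ?h"
    by (auto simp: continuous_map_in_subtopology continuous_map_componentwise
        shift_in_standard_simplex continuous_map_from_subtopology)
  then have "continuous_map (subtopology (powertop_real UNIV) (standard_simplex q)) X (f \<circ> ?h)"
    using assms continuous_map_compose unfolding singular_simplex_def by blast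
  then show ?thesis
    unfolding singular_simplex_def back_face_def
    by (auto elim!: continuous_map_eq)
qed

lemma front_face_singular_face:
  assumes "k \<le> Suc p"
  shows "front_face p (singular_face (Suc (p + q)) k f) = singular_face (Suc p) k (front_face (Suc p) f)"
proof
  fix t
  have "t \<in> standard_simplex p \<Longrightarrow> t \<in> standard_simplex (p + q)"
    using standard_simplex_mono[of p "p + q"] by auto
  then show "front_face p (singular_face (Suc (p + q)) k f) t =
             singular_face (Suc p) k (front_face (Suc p) f) t"
    using assms simplical_face_in_standard_simplex[of "Suc p" k t]
    by (simp add: front_face_def singular_face_def)
qed

lemma front_face_singular_face':
  assumes "p < k"
  shows "front_face p (singular_face (Suc (p + q)) k f) = front_face p f"
proof
  fix t
  have "t \<in> standard_simplex p \<Longrightarrow> t \<in> standard_simplex (p + q)"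
    using standard_simplex_mono[of p "p + q"] by auto
  moreover have "t \<in> standard_simplex p \<Longrightarrow> simplical_face k t = t"
    using assms by (auto simp: simplical_face_def standard_simplex_def)
  ultimately show "front_face p (singular_face (Suc (p + q)) k f) t = front_face p f t"
    by (simp add: front_face_def singular_face_def)
qed

lemma back_face_singular_face:
  assumes "k \<le> p"
  shows "back_face p q (singular_face (Suc (p + q)) k f) = back_face (Suc p) q f"
proof
  fix t :: "nat \<Rightarrow> real"
  have "simplical_face k (\<lambda>i. if i < p then 0 else t (i - p)) =
        (\<lambda>i. if i < Suc p then 0 else t (i - Suc p))"
    using assms by (auto simp: simplical_face_def fun_eq_iff less_Suc_eq)
  then show "back_face p q (singular_face (Suc (p + q)) k f) t = back_face (Suc p) q f t"
    by (simp add: back_face_def singular_face_def shift_in_standard_simplex)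
qed

lemma back_face_singular_face':
  assumes "k \<le> Suc q"
  shows "back_face p q (singular_face (Suc (p + q)) (p + k) f) =
         singular_face (Suc q) k (back_face p (Suc q) f)"
proof
  fix t :: "nat \<Rightarrow> real"
  have "simplical_face (p + k) (\<lambda>i. if i < p then 0 else t (i - p)) =
        (\<lambda>i. if i < p then 0 else simplical_face k t (i - p))"
    by (auto simp: simplical_face_def fun_eq_iff)
  then show "back_face p q (singular_face (Suc (p + q)) (p + k) f) t =
             singular_face (Suc q) k (back_face p (Suc q) f) t"
    using assms simplical_face_in_standard_simplex[of "Suc q" k t]
    by (simp add: back_face_def singular_face_def shift_in_standard_simplex)
qed

lemma coboundary_cochain_cup:
  "coboundary (p + q) X (cochain_cup p q X a b) =
     (\<lambda>f. cochain_cup (Suc p) q X (coboundary p X a) b f +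
          cochain_cup p (Suc q) X a (coboundary q X b) f)"
proof
  fix f
  show "coboundary (p + q) X (cochain_cup p q X a b) f =
        cochain_cup (Suc p) q X (coboundary p X a) b f +
        cochain_cup p (Suc q) X a (coboundary q X b) f"
  proof (cases "singular_simplex (Suc (p + q)) X f")
    case True
    let ?F = "\<lambda>k. a (front_face p (singular_face (Suc (p + q)) k f)) *
                  b (back_face p q (singular_face (Suc (p + q)) k f))"
    let ?m = "a (front_face p f) * b (back_face (Suc p) q f)"
    have faces: "singular_simplex (p + q) X (singular_face (Suc (p + q)) k f)" if "k \<le> Suc (p + q)" for k
      using singular_simplex_singular_face[OF True, of k] that by simp
    have frontf: "singular_simplex (Suc p) X (front_face (Suc p) f)"
      using True front_face_singular_simplex[of "Suc p" q] by simp
    have backf: "singular_simplex (Suc q) X (back_face p (Suc q) f)"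
      using True back_face_singular_simplex[of p "Suc q"] by simp
    have "coboundary (p + q) X (cochain_cup p q X a b) f = (\<Sum>k\<le>Suc (p + q). ?F k)"
      using True faces by (simp add: coboundary_def cochain_cup_def del: sum.atMost_Suc)
    also have "\<dots> = (\<Sum>k\<le>p. ?F k) + (\<Sum>k\<in>{Suc p..Suc (p + q)}. ?F k)"
    proof -
      have "{..Suc (p + q)} = {..p} \<union> {Suc p..Suc (p + q)}"
        by auto
      then show ?thesis
        by (simp add: sum.union_disjoint del: sum.atMost_Suc sum.cl_ivl_Suc)
    qed
    also have "(\<Sum>k\<in>{Suc p..Suc (p + q)}. ?F k) = (\<Sum>j\<in>{1..Suc q}. ?F (p + j))"
      by (rule sum.reindex_bij_witness[of _ "\<lambda>j. p + j" "\<lambda>k. k - p"]) auto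
    also have "(\<Sum>k\<le>p. ?F k) =
        (\<Sum>k\<le>p. a (singular_face (Suc p) k (front_face (Suc p) f)) * b (back_face (Suc p) q f))"
      by (intro sum.cong) (auto simp: front_face_singular_face back_face_singular_face)
    also have "\<dots> = cochain_cup (Suc p) q X (coboundary p X a) b f + ?m"
    proof -
      have "singular_face (Suc p) (Suc p) (front_face (Suc p) f) = front_face p f"
        using front_face_singular_face[of "Suc p" p q f] front_face_singular_face'[of p "Suc p" q f]
        by simp
      then show ?thesis
        using True frontf
        by (simp add: cochain_cup_def coboundary_def sum_distrib_right distrib_right add.assoc bit_add_self)
    qed
    also have "(\<Sum>j\<in>{1..Suc q}. ?F (p + j)) =
        (\<Sum>j\<in>{1..Suc q}. a (front_face p f) * b (singular_face (Suc q) j (back_face p (Suc q) f)))"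
      by (intro sum.cong) (auto simp: front_face_singular_face' back_face_singular_face')
    also have "\<dots> = ?m + cochain_cup p (Suc q) X a (coboundary q X b) f"
    proof -
      have "singular_face (Suc q) 0 (back_face p (Suc q) f) = back_face (Suc p) q f"
        using back_face_singular_face[of p p q f] back_face_singular_face'[of 0 q p f]
        by simp
      moreover have "{..Suc q} = insert 0 {1..Suc q}"
        by auto
      ultimately show ?thesis
        using True backf
        by (simp add: cochain_cup_def coboundary_def sum_distrib_left distrib_left
            add.assoc[symmetric] bit_add_self del: sum.atMost_Suc sum.cl_ivl_Suc)
    qed
    finally show ?thesis
      by (metis add.assoc add.right_neutral bit_add_self)
  qed (simp add: coboundary_def cochain_cup_def)
qed

lemma cochain_cup_in_carrier: "cochain_cup p q X a b \<in> carrier (cochain_group (p + q) X)"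
  by (simp add: carrier_cochain_group cochain_cup_def)

lemma cochain_cup_zero [simp]:
  "cochain_cup p q X (\<lambda>_. 0) b = (\<lambda>_. 0)" "cochain_cup p q X a (\<lambda>_. 0) = (\<lambda>_. 0)"
  by (simp_all add: cochain_cup_def fun_eq_iff)

lemma cochain_cup_in_cocycles:
  assumes "a \<in> cocycles p X" "b \<in> cocycles q X"
  shows "cochain_cup p q X a b \<in> cocycles (p + q) X"
  using assms by (simp add: cocycles_def cochain_cup_in_carrier coboundary_cochain_cup)

lemma cochain_cup_coboundaries:
  assumes "a \<in> cocycles p X" "b \<in> coboundaries q X"
  shows "cochain_cup p q X a b \<in> coboundaries (p + q) X"
proof (cases q)
  case (Suc n)
  with assms obtain c where "b = coboundary n X c"
    by auto
  moreover have "coboundary p X a = (\<lambda>_. 0)"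
    using assms by (simp add: cocycles_def)
  ultimately have "cochain_cup p q X a b = coboundary (p + n) X (cochain_cup p n X a c)"
    by (simp add: coboundary_cochain_cup Suc)
  then show ?thesis
    by (simp add: Suc cochain_cup_in_carrier)
qed (use assms in \<open>simp add: zero_in_coboundaries\<close>)

lemma coboundaries_cochain_cup:
  assumes "a \<in> coboundaries p X" "b \<in> cocycles q X"
  shows "cochain_cup p q X a b \<in> coboundaries (p + q) X"
proof (cases p)
  case 0
  with assms show ?thesis
    using zero_in_coboundaries[of q X] by auto
next
  case (Suc n)
  with assms obtain c where "a = coboundary n X c"
    by auto
  moreover have "coboundary q X b = (\<lambda>_. 0)"
    using assms by (simp add: cocycles_def)
  ultimately have "cochain_cup p q X a b = coboundary (n + q) X (cochain_cup n q X c b)"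
    by (simp add: coboundary_cochain_cup Suc)
  then show ?thesis
    by (simp add: Suc cochain_cup_in_carrier)
qed

lemma cup_product_coset:
  assumes a: "a \<in> cocycles p X" and b: "b \<in> cocycles q X"
  shows "cup_product p q X (coboundaries p X #>\<^bsub>cochain_group p X\<^esub> a)
             (coboundaries q X #>\<^bsub>cochain_group q X\<^esub> b) =
         coboundaries (p + q) X #>\<^bsub>cochain_group (p + q) X\<^esub> cochain_cup p q X a b"
proof -
  let ?B = "coboundaries (p + q) X"
  let ?G = "cochain_group (p + q) X"
  have "?B #>\<^bsub>?G\<^esub> cochain_cup p q X (\<lambda>f. u f + a f) (\<lambda>f. v f + b f) = ?B #>\<^bsub>?G\<^esub> cochain_cup p q X a b"
    if u: "u \<in> coboundaries p X" and v: "v \<in> coboundaries q X" for u v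
  proof -
    have vb: "(\<lambda>f. v f + b f) \<in> cocycles q X"
      using subgroup.m_closed[OF subgroup_cocycles, of v q X b] v b coboundaries_subset_cocycles
      by auto
    let ?w = "\<lambda>f. cochain_cup p q X u (\<lambda>f. v f + b f) f + cochain_cup p q X a v f"
    have w: "?w \<in> ?B"
      by (intro add_in_coboundaries coboundaries_cochain_cup cochain_cup_coboundaries u v a vb)
    have "cochain_cup p q X (\<lambda>f. u f + a f) (\<lambda>f. v f + b f) =
          ?w \<otimes>\<^bsub>?G\<^esub> cochain_cup p q X a b"
      by (auto simp: cochain_cup_def fun_eq_iff algebra_simps)
    then show ?thesis
      using w group.repr_independence[OF group_cochain_group _ cochain_cup_in_carrier subgroup_coboundaries]
      by (metis (no_types, lifting) UN_I r_coset_def singletonI)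
  qed
  then show ?thesis
    using zero_in_coboundaries[of p X] zero_in_coboundaries[of q X]
    by (force simp: cup_product_def r_coset_def[of "cochain_group p X"] r_coset_def[of "cochain_group q X"])
qed

lemma cochain_unit_in_cocycles: "cochain_unit X \<in> cocycles 0 X"
proof -
  have "singular_simplex 0 X (singular_face (Suc 0) k f)"
    if "singular_simplex (Suc 0) X f" "k \<le> Suc 0" for f k
    using singular_simplex_singular_face[OF that(1) _ that(2)] by simp
  then show ?thesis
    by (auto simp: cocycles_def carrier_cochain_group cochain_unit_def coboundary_def fun_eq_iff)
qed

section \<open>Topological group actions\<close>

text \<open>The acting group carries the discrete topology.\<close>

definition continuous_group_action ::
    "('g, 'm) monoid_scheme \<Rightarrow> 'a topology \<Rightarrow> ('g \<Rightarrow> 'a \<Rightarrow> 'a) \<Rightarrow> bool" where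
  "continuous_group_action G X \<phi> \<longleftrightarrow>
     group_action G (topspace X) \<phi> \<and> (\<forall>g \<in> carrier G. continuous_map X X (\<phi> g))"

definition free_group_action ::
    "('g, 'm) monoid_scheme \<Rightarrow> 'a topology \<Rightarrow> ('g \<Rightarrow> 'a \<Rightarrow> 'a) \<Rightarrow> bool" where
  "free_group_action G X \<phi> \<longleftrightarrow>
     continuous_group_action G X \<phi> \<and> (\<forall>x \<in> topspace X. stabilizer G \<phi> x = {\<one>\<^bsub>G\<^esub>})"

definition orbit_space ::
    "('g, 'm) monoid_scheme \<Rightarrow> 'a topology \<Rightarrow> ('g \<Rightarrow> 'a \<Rightarrow> 'a) \<Rightarrow> 'a set topology" where
  "orbit_space G X \<phi> = quotient_topology X (orbit G \<phi>)"

definition equivariant_map ::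
    "('g, 'm) monoid_scheme \<Rightarrow> 'a topology \<Rightarrow> ('g \<Rightarrow> 'a \<Rightarrow> 'a) \<Rightarrow>
     'b topology \<Rightarrow> ('g \<Rightarrow> 'b \<Rightarrow> 'b) \<Rightarrow> ('a \<Rightarrow> 'b) \<Rightarrow> bool" where
  "equivariant_map G X \<phi> Y \<psi> f \<longleftrightarrow>
     continuous_map X Y f \<and> (\<forall>g \<in> carrier G. \<forall>x \<in> topspace X. f (\<phi> g x) = \<psi> g (f x))"

end

theory Submission
  imports Defs "HOL-Analysis.Abstract_Topological_Spaces" "HOL-Computational_Algebra.Polynomial"
begin

text \<open>Write \<open>\<pi>\<close> for the projection of \<open>Y\<close> onto its orbit space, \<open>\<sigma>\<close> for the involution of \<open>Y\<close>, and choose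
  a function \<open>\<epsilon>\<close> on \<open>Y\<close> with values in the field of two elements such that \<open>\<epsilon> \<circ> \<sigma> = \<epsilon> + 1\<close>. The
  coboundary of \<open>\<epsilon>\<close> descends to a cocycle \<open>w\<close> on the orbit space, and \<open>w \<union> w = \<delta> c\<close> because the second
  cohomology vanishes. Given an equivariant map \<open>f\<close> from \<open>X\<close> with involution \<open>\<tau>\<close>, put \<open>e = \<epsilon> \<circ> f\<close>. Then
  the pullback of \<open>c\<close> along \<open>\<pi> \<circ> f\<close> plus \<open>e \<union> \<delta> e\<close> is a 1-cocycle on \<open>X\<close>, hence equal to \<open>\<delta> g\<close>, since
  the first cohomology of \<open>X\<close> is zero. Adding its translate under \<open>\<tau>\<close> gives \<open>\<delta> (g + g \<circ> \<tau>) = \<delta> e\<close>, so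
  \<open>g + g \<circ> \<tau> + e\<close> is constant, \<open>X\<close> being connected; but composing it with \<open>\<tau>\<close> adds 1.

  The Milnor manifold is covered by affine cells which have a common point and path-connected pairwise
  intersections, so it is path connected with zero first cohomology.\<close>

section \<open>One-dimensional cocycles\<close>

definition simplex_vertex :: "nat \<Rightarrow> nat \<Rightarrow> real" where
  "simplex_vertex k = (\<lambda>i. if i = k then 1 else 0)"

definition point_simplex :: "'a \<Rightarrow> (nat \<Rightarrow> real) \<Rightarrow> 'a" where
  "point_simplex x = restrict (\<lambda>_. x) (standard_simplex 0)"

lemma simplex_vertex_in_standard_simplex [simp]: "simplex_vertex k \<in> standard_simplex p \<longleftrightarrow> k \<le> p"
  by (simp add: simplex_vertex_def)

lemma standard_simplex_0_eq: "standard_simplex 0 = {simplex_vertex 0}"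
  by (simp add: standard_simplex_0 simplex_vertex_def)

lemma point_simplex_vertex [simp]: "point_simplex x (simplex_vertex 0) = x"
  by (simp add: point_simplex_def)

lemma singular_simplex_point_simplex:
  "x \<in> topspace X \<Longrightarrow> singular_simplex 0 X (point_simplex x)"
  unfolding singular_simplex_def point_simplex_def
  by (auto intro: continuous_map_eq[of _ _ "\<lambda>_. x"])

lemma singular_simplex_in_topspace:
  "singular_simplex p X f \<Longrightarrow> t \<in> standard_simplex p \<Longrightarrow> f t \<in> topspace X"
  unfolding singular_simplex_def continuous_map_def by auto

lemma singular_simplex_0_eq:
  assumes "singular_simplex 0 X v"
  shows "v = point_simplex (v (simplex_vertex 0))"
proof
  fix t
  show "v t = point_simplex (v (simplex_vertex 0)) t"
    using assms unfolding singular_simplex_def point_simplex_def standard_simplex_0_eq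
    by (cases "t = simplex_vertex 0") (auto simp: extensional_def)
qed

lemma singular_face_vertex:
  assumes "k \<le> Suc p" "i \<le> p"
  shows "singular_face (Suc p) k f (simplex_vertex i) = f (simplex_vertex (if i < k then i else Suc i))"
proof -
  have "simplical_face k (simplex_vertex i) = simplex_vertex (if i < k then i else Suc i)"
    by (auto simp: simplical_face_def simplex_vertex_def fun_eq_iff)
  then show ?thesis
    using assms by (simp add: singular_face_def)
qed

text \<open>Deleting vertex \<open>k\<close> of an edge leaves the other vertex, whose index is
  \<open>1 - k\<close>.\<close>

lemma singular_face_1:
  assumes "k \<le> Suc 0"
  shows "singular_face (Suc 0) k f = point_simplex (f (simplex_vertex (Suc 0 - k)))"
proof
  fix t
  show "singular_face (Suc 0) k f t = point_simplex (f (simplex_vertex (Suc 0 - k))) t"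
  proof (cases "t = simplex_vertex 0")
    case True
    then show ?thesis
      using assms singular_face_vertex[of k 0 0 f] by (cases k) auto
  next
    case False
    then show ?thesis
      by (simp add: singular_face_def point_simplex_def standard_simplex_0_eq)
  qed
qed

lemma coboundary_0:
  assumes "singular_simplex 1 X u"
  shows "coboundary 0 X g u =
    g (point_simplex (u (simplex_vertex 0))) + g (point_simplex (u (simplex_vertex 1)))"
  using assms by (simp add: coboundary_def singular_face_1 add.commute)

lemma coboundary_1:
  assumes "singular_simplex 2 X u"
  shows "coboundary (Suc 0) X c u =
    c (singular_face 2 0 u) + c (singular_face 2 1 u) + c (singular_face 2 2 u)"
  using assms by (simp add: coboundary_def numeral_2_eq_2)

text \<open>Off the 2-simplices \<open>coboundary\<close> is 0 by definition, so only these have to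
  be tested.\<close>

lemma cocycle_1_iff:
  "c \<in> cocycles 1 X \<longleftrightarrow> c \<in> carrier (cochain_group 1 X) \<and> (\<forall>u. singular_simplex 2 X u \<longrightarrow>
     c (singular_face 2 0 u) + c (singular_face 2 1 u) + c (singular_face 2 2 u) = 0)"
proof -
  have "coboundary 1 X c = (\<lambda>_. 0) \<longleftrightarrow> (\<forall>u. singular_simplex 2 X u \<longrightarrow> coboundary 1 X c u = 0)"
    by (auto simp: fun_eq_iff coboundary_def numeral_2_eq_2)
  then show ?thesis
    by (simp add: cocycles_def coboundary_1)
qed

lemma coboundaries_1_I:
  fixes g :: "'a \<Rightarrow> bit"
  assumes "c \<in> carrier (cochain_group 1 X)"
    and "\<And>u. singular_simplex 1 X u \<Longrightarrow> c u = g (u (simplex_vertex 0)) + g (u (simplex_vertex 1))"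
  shows "c \<in> coboundaries 1 X"
proof -
  \<comment> \<open>A cochain lives on 0-simplices and must vanish off them, so the function on
    points is read at the only vertex and cut off.\<close>
  let ?g = "\<lambda>v. if singular_simplex 0 X v then g (v (simplex_vertex 0)) else 0"
  have "c u = coboundary 0 X ?g u" for u
  proof (cases "singular_simplex 1 X u")
    case True
    then show ?thesis
      using assms(2) by (simp add: coboundary_0 singular_simplex_point_simplex singular_simplex_in_topspace)
  next
    case False
    then show ?thesis
      using assms(1) by (simp add: coboundary_def carrier_cochain_group)
  qed
  then have "c = coboundary 0 X ?g" ..
  then show ?thesis
    by (auto simp: carrier_cochain_group)
qed

lemma coboundaries_1_E:
  assumes "c \<in> coboundaries 1 X"
  obtains g :: "'a \<Rightarrow> bit" where
    "\<And>u. singular_simplex 1 X u \<Longrightarrow> c u = g (u (simplex_vertex 0)) + g (u (simplex_vertex 1))"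
proof -
  obtain h where "c = coboundary 0 X h"
    using assms by auto
  show thesis
  proof (rule that)
    fix u assume "singular_simplex 1 X u"
    then show "c u = h (point_simplex (u (simplex_vertex 0))) + h (point_simplex (u (simplex_vertex 1)))"
      unfolding \<open>c = coboundary 0 X h\<close> by (rule coboundary_0)
  qed
qed

section \<open>Affine edges and triangles in a space\<close>

lemma continuous_on_coordinate: "continuous_on S (\<lambda>t::nat \<Rightarrow> real. t i)"
  by (rule continuous_on_subset[OF continuous_on_product_coordinates subset_UNIV])

text \<open>Straight edges of a normed space pushed forward by \<open>G\<close>: the later
  computations with 1-cocycles take place on an interval or a square in the domain of
  \<open>G\<close>.\<close>

definition affine_edge :: "('e::real_normed_vector \<Rightarrow> 'a) \<Rightarrow> 'e \<Rightarrow> 'e \<Rightarrow> (nat \<Rightarrow> real) \<Rightarrow> 'a" where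
  "affine_edge G p q = restrict (\<lambda>t. G (t 0 *\<^sub>R p + t 1 *\<^sub>R q)) (standard_simplex 1)"

definition affine_triangle :: "('e::real_normed_vector \<Rightarrow> 'a) \<Rightarrow> 'e \<Rightarrow> 'e \<Rightarrow> 'e \<Rightarrow> (nat \<Rightarrow> real) \<Rightarrow> 'a" where
  "affine_triangle G p q r = restrict (\<lambda>t. G (t 0 *\<^sub>R p + t 1 *\<^sub>R q + t 2 *\<^sub>R r)) (standard_simplex 2)"

lemma standard_simplex_1_D:
  "t \<in> standard_simplex (Suc 0) \<Longrightarrow> 0 \<le> t 0 \<and> 0 \<le> t (Suc 0) \<and> t 0 + t (Suc 0) = 1"
  by (simp add: standard_simplex_def)

lemma standard_simplex_2_D:
  "t \<in> standard_simplex 2 \<Longrightarrow> 0 \<le> t 0 \<and> 0 \<le> t 1 \<and> 0 \<le> t 2 \<and> t 0 + t 1 + t 2 = 1"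
  by (simp add: standard_simplex_def numeral_2_eq_2)

lemma singular_simplex_restrict:
  assumes "continuous_map (top_of_set (S::'e::real_normed_vector set)) X G"
    and "continuous_on (standard_simplex p) (h :: (nat \<Rightarrow> real) \<Rightarrow> 'e)"
    and "h ` standard_simplex p \<subseteq> S"
  shows "singular_simplex p X (restrict (\<lambda>t. G (h t)) (standard_simplex p))"
proof -
  have "continuous_map (top_of_set (standard_simplex p)) (top_of_set S) h"
    using assms by (auto simp: continuous_map_in_subtopology)
  then have "continuous_map (top_of_set (standard_simplex p)) X (G \<circ> h)"
    using assms(1) continuous_map_compose by blast
  then show ?thesis
    unfolding singular_simplex_def euclidean_product_topology[symmetric]
    by (auto elim!: continuous_map_eq)
qed

lemma singular_simplex_affine_edge:
  assumes "continuous_map (top_of_set S) X G" "convex S" "p \<in> S" "q \<in> S"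
  shows "singular_simplex 1 X (affine_edge G p q)"
  unfolding affine_edge_def
proof (rule singular_simplex_restrict[OF assms(1)])
  show "continuous_on (standard_simplex 1) (\<lambda>t::nat\<Rightarrow>real. t 0 *\<^sub>R p + t 1 *\<^sub>R q)"
    by (intro continuous_intros continuous_on_coordinate)
  show "(\<lambda>t. t 0 *\<^sub>R p + t 1 *\<^sub>R q) ` standard_simplex 1 \<subseteq> S"
    using assms by (auto dest!: standard_simplex_1_D intro!: convexD)
qed

lemma singular_simplex_affine_triangle:
  assumes "continuous_map (top_of_set S) X G" "convex S" "p \<in> S" "q \<in> S" "r \<in> S"
  shows "singular_simplex 2 X (affine_triangle G p q r)"
  unfolding affine_triangle_def
proof (rule singular_simplex_restrict[OF assms(1)])
  show "continuous_on (standard_simplex 2) (\<lambda>t::nat\<Rightarrow>real. t 0 *\<^sub>R p + t 1 *\<^sub>R q + t 2 *\<^sub>R r)"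
    by (intro continuous_intros continuous_on_coordinate)
  show "(\<lambda>t. t 0 *\<^sub>R p + t 1 *\<^sub>R q + t 2 *\<^sub>R r) ` standard_simplex 2 \<subseteq> S"
  proof
    fix x assume "x \<in> (\<lambda>t. t 0 *\<^sub>R p + t 1 *\<^sub>R q + t 2 *\<^sub>R r) ` standard_simplex 2"
    then obtain t where t: "t \<in> standard_simplex 2" "x = t 0 *\<^sub>R p + t 1 *\<^sub>R q + t 2 *\<^sub>R r"
      by auto
    have "x \<in> convex hull {p, q, r}"
      unfolding convex_hull_3 using standard_simplex_2_D[OF t(1)] t(2) by auto
    then show "x \<in> S"
      using assms hull_minimal[of "{p,q,r}" S convex] by auto
  qed
qed

lemma faces_affine_triangle:
  "singular_face 2 0 (affine_triangle G p q r) = affine_edge G q r"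
  "singular_face 2 1 (affine_triangle G p q r) = affine_edge G p r"
  "singular_face 2 2 (affine_triangle G p q r) = affine_edge G p q"
proof -
  have *: "simplical_face k t \<in> standard_simplex 2" if "k \<le> 2" "t \<in> standard_simplex 1" for k t
    using simplical_face_in_standard_simplex[of 2 k t] that by (simp add: numeral_2_eq_2)
  note * = this[of 0] this[of 1] this[of 2]
  from * show
    "singular_face 2 0 (affine_triangle G p q r) = affine_edge G q r"
    "singular_face 2 1 (affine_triangle G p q r) = affine_edge G p r"
    "singular_face 2 2 (affine_triangle G p q r) = affine_edge G p q"
    by (auto simp: fun_eq_iff singular_face_def affine_triangle_def affine_edge_def restrict_def) (auto simp: simplical_face_def)
qed

text \<open>The triangle stays in \<open>S\<close> by convexity, and the cocycle vanishes on its
  boundary. The points may be collinear or coincide, which gives additivity along an interval and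
  the value 0 on constant edges.\<close>

lemma cocycle_affine_edge:
  assumes "c \<in> cocycles 1 X" "continuous_map (top_of_set S) X G" "convex S" "p \<in> S" "q \<in> S" "r \<in> S"
  shows "c (affine_edge G p r) = c (affine_edge G p q) + c (affine_edge G q r)"
proof -
  have "c (affine_edge G q r) + c (affine_edge G p r) + c (affine_edge G p q) = 0"
    using assms(1) singular_simplex_affine_triangle[OF assms(2-)]
    unfolding cocycle_1_iff by (metis faces_affine_triangle)
  then show ?thesis
    by (metis add.assoc add.commute add.right_neutral bit_add_self)
qed

lemma affine_edge_vertex [simp]:
  "affine_edge G p q (simplex_vertex 0) = G p" "affine_edge G p q (simplex_vertex 1) = G q"
  "affine_edge G p q (simplex_vertex (Suc 0)) = G q"
  by (simp_all add: affine_edge_def) (simp_all add: simplex_vertex_def)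

text \<open>Reading an edge as a path on \<open>{0..1}\<close> makes the additivity of
  \<open>cocycle_affine_edge\<close> available for its pieces.\<close>

lemma singular_simplex_as_affine_edge:
  fixes u :: "(nat \<Rightarrow> real) \<Rightarrow> 'a"
  assumes "singular_simplex 1 X u"
  obtains \<gamma> :: "real \<Rightarrow> 'a" where "continuous_map (top_of_set {0..1}) X \<gamma>" "affine_edge \<gamma> 0 1 = u"
    "\<gamma> 0 = u (simplex_vertex 0)" "\<gamma> 1 = u (simplex_vertex 1)"
proof -
  \<comment> \<open>The standard 1-simplex is parametrized by its coordinate of index 1.\<close>
  define \<gamma> where "\<gamma> = (\<lambda>s::real. u (\<lambda>i. if i = 0 then 1 - s else if i = 1 then s else 0))"
  let ?l = "\<lambda>s::real. (\<lambda>i::nat. if i = 0 then 1 - s else if i = 1 then s else 0)"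
  have "continuous_on {0..1} ?l"
  proof (rule continuous_on_coordinatewise_then_product)
    fix i
    show "continuous_on {0..1} (\<lambda>s. ?l s i)"
      by (cases "i = 0"; cases "i = 1") (auto intro!: continuous_intros)
  qed
  moreover have "?l ` {0..1} \<subseteq> standard_simplex 1"
    by (auto simp: standard_simplex_def)
  ultimately have "continuous_map (top_of_set {0..1}) (top_of_set (standard_simplex 1)) ?l"
    by (auto simp: continuous_map_in_subtopology)
  moreover have "continuous_map (top_of_set (standard_simplex 1)) X u"
    using assms unfolding singular_simplex_def euclidean_product_topology by auto
  ultimately have "continuous_map (top_of_set {0..1}) X (u \<circ> ?l)"
    by (rule continuous_map_compose)
  then have 1: "continuous_map (top_of_set {0..1}) X \<gamma>"
    by (simp add: \<gamma>_def o_def)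
  have "affine_edge \<gamma> 0 1 t = u t" for t
  proof (cases "t \<in> standard_simplex 1")
    case True
    have "?l (t 1) = t"
    proof
      fix i show "?l (t 1) i = t i"
        using True standard_simplex_1_D[OF True[unfolded One_nat_def]] by (auto simp: standard_simplex_def)
    qed
    moreover have "affine_edge \<gamma> 0 1 t = \<gamma> (t 1)"
      using True by (simp add: affine_edge_def)
    ultimately show ?thesis
      by (simp only: \<gamma>_def)
  next
    case False
    then show ?thesis
      using assms(1) by (auto simp: affine_edge_def singular_simplex_def extensional_def)
  qed
  then have "affine_edge \<gamma> 0 1 = u" ..
  moreover have "\<gamma> 0 = u (simplex_vertex 0)" "\<gamma> 1 = u (simplex_vertex 1)"
    by (auto simp: \<gamma>_def simplex_vertex_def intro!: arg_cong[of _ _ u])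
  ultimately show thesis
    using that[OF 1] by blast
qed

section \<open>Primitives of 1-cocycles on contractible spaces and on open covers\<close>

definition exact_on :: "'a topology \<Rightarrow> (((nat \<Rightarrow> real) \<Rightarrow> 'a) \<Rightarrow> bit) \<Rightarrow> bool" where
  "exact_on X c \<longleftrightarrow> (\<exists>g. \<forall>u. singular_simplex 1 X u \<longrightarrow>
     c u = g (u (simplex_vertex 0)) + g (u (simplex_vertex 1)))"

text \<open>The primitive at \<open>x\<close> is the value of \<open>c\<close> on the track of
  \<open>x\<close> under the contraction. The square swept out by an edge compares that edge with
  the tracks of its endpoints.\<close>

lemma exact_on_contractible:
  assumes c: "c \<in> cocycles 1 X" and contr: "contractible_space X"
  shows "exact_on X c"
proof -
  obtain a where "homotopic_with (\<lambda>x. True) X X id (\<lambda>x. a)"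
    using contr unfolding contractible_space_def by blast
  then obtain h where h: "continuous_map (prod_topology (top_of_set {0..1::real}) X) X h"
      and h0: "\<And>x. h (0, x) = x" and h1: "\<And>x. h (1, x) = a"
    unfolding homotopic_with_def by auto
  let ?e = "\<lambda>x. c (affine_edge (\<lambda>s. h (s, x)) 0 1)"
  have "c u = ?e (u (simplex_vertex 0)) + ?e (u (simplex_vertex 1))" if u: "singular_simplex 1 X u" for u
  proof -
    obtain \<gamma> :: "real \<Rightarrow> _" where \<gamma>: "continuous_map (top_of_set {0..1}) X \<gamma>" "affine_edge \<gamma> 0 1 = u"
        "\<gamma> 0 = u (simplex_vertex 0)" "\<gamma> 1 = u (simplex_vertex 1)"
      by (rule singular_simplex_as_affine_edge[OF u])
    \<comment> \<open>In this square the side \<open>s = 0\<close> is \<open>u\<close>, the sides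
      \<open>t = 0\<close> and \<open>t = 1\<close> are tracks of the endpoints, and the side
      \<open>s = 1\<close> is constant. The diagonal from \<open>(0,0)\<close> to
      \<open>(1,1)\<close> is evaluated in both triangles.\<close>
    define G where "G = (\<lambda>(s, t). h (s, \<gamma> t))"
    let ?S = "{0..1::real} \<times> {0..1::real}"
    have conv: "convex ?S"
      by (simp add: convex_Times)
    have "continuous_map (top_of_set ?S) (prod_topology (top_of_set {0..1}) X) (\<lambda>(s, t). (s, \<gamma> t))"
      using \<gamma>(1) unfolding prod_topology_subtopology_eu[symmetric] continuous_map_prod_top by simp
    then have "continuous_map (top_of_set ?S) X (h \<circ> (\<lambda>(s, t). (s, \<gamma> t)))"
      using h continuous_map_compose by metis
    then have G: "continuous_map (top_of_set ?S) X G"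
      by (simp add: G_def o_def case_prod_unfold)
    note E = cocycle_affine_edge[OF c G conv]
    have 1: "affine_edge G (0,0) (0,1) = u"
      unfolding \<gamma>(2)[symmetric] by (auto simp: affine_edge_def G_def h0 fun_eq_iff restrict_def)
    have 2: "affine_edge G (0,x) (1,x) = affine_edge (\<lambda>s. h (s, \<gamma> x)) 0 1" for x
      by (auto simp: affine_edge_def G_def fun_eq_iff restrict_def simp flip: distrib_right) (simp add: standard_simplex_1_D)
    have 3: "affine_edge G (1,0) (1,1) = affine_edge G (1,0) (1,0)"
      by (auto simp: affine_edge_def G_def h1 fun_eq_iff restrict_def dest!: standard_simplex_1_D)
    \<comment> \<open>A triangle degenerated to a point gives \<open>x = x + x\<close>, hence
      \<open>x = 0\<close>.\<close>
    have "c (affine_edge G (1,0) (1,0)) = 0"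
      using E[of "(1,0)" "(1,0)" "(1,0)"] by (auto simp: bit_add_self)
    then have "c (affine_edge G (0,0) (1,1)) = ?e (\<gamma> 0)"
      using E[of "(0,0)" "(1,0)" "(1,1)"] by (simp add: 2 3)
    moreover have "c (affine_edge G (0,0) (1,1)) = c u + ?e (\<gamma> 1)"
      using E[of "(0,0)" "(0,1)" "(1,1)"] by (simp add: 1 2)
    ultimately have "c u = ?e (\<gamma> 0) + ?e (\<gamma> 1)"
      by (cases "c u"; cases "?e (\<gamma> 0)"; cases "?e (\<gamma> 1)") simp_all
    then show ?thesis
      by (simp only: \<gamma>(3,4))
  qed
  then show ?thesis
    unfolding exact_on_def by (intro exI[of _ ?e]) blast
qed

lemma path_simplex:
  assumes "path_connectedin X S" "x \<in> S" "y \<in> S"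
  obtains u where "singular_simplex 1 (subtopology X S) u"
    "u (simplex_vertex 0) = x" "u (simplex_vertex 1) = y"
proof -
  have "path_connected_space (subtopology X S)" "S \<subseteq> topspace X"
    using assms by (auto simp: path_connectedin_def)
  then obtain g where g: "pathin (subtopology X S) g" "g 0 = x" "g 1 = y"
    using assms unfolding path_connected_space_def by (metis topspace_subtopology_subset)
  then have "singular_simplex 1 (subtopology X S) (affine_edge g 0 1)"
    unfolding pathin_def by (intro singular_simplex_affine_edge[of "{0..1}"]) auto
  with g show thesis
    by (intro that[of "affine_edge g 0 1"]) simp_all
qed

text \<open>Cochains of the subspace must be 0 off its own simplices, hence the cut-off; it is
  harmless because faces of a simplex in \<open>U\<close> stay in \<open>U\<close>.\<close>

lemma cocycle_1_subtopology:
  assumes "c \<in> cocycles 1 X"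
  shows "(\<lambda>u. if singular_simplex 1 (subtopology X U) u then c u else 0) \<in> cocycles 1 (subtopology X U)"
proof -
  have "singular_simplex 2 X u" if "singular_simplex 2 (subtopology X U) u" for u
    using that by (auto simp: singular_simplex_subtopology)
  moreover have "singular_simplex 1 (subtopology X U) (singular_face 2 k u)"
    if u: "singular_simplex 2 (subtopology X U) u" and k: "k \<le> 2" for u k
    using singular_simplex_singular_face[OF u _ k] by simp
  ultimately show ?thesis
    using assms unfolding cocycle_1_iff by (auto simp: carrier_cochain_group)
qed

text \<open>The common base point makes the local primitives agree on overlaps.\<close>

lemma coboundaries_open_cover:
  assumes c: "c \<in> cocycles 1 X"
    and opn: "\<And>U. U \<in> \<U> \<Longrightarrow> openin X U" and cover: "topspace X \<subseteq> \<Union>\<U>"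
    and contr: "\<And>U. U \<in> \<U> \<Longrightarrow> contractible_space (subtopology X U)"
    and conn: "\<And>U V. U \<in> \<U> \<Longrightarrow> V \<in> \<U> \<Longrightarrow> path_connectedin X (U \<inter> V)"
    and base: "\<And>U. U \<in> \<U> \<Longrightarrow> x0 \<in> U"
  shows "c \<in> coboundaries 1 X"
proof -
  have "\<exists>g. (\<forall>u. singular_simplex 1 (subtopology X U) u \<longrightarrow>
          c u = g (u (simplex_vertex 0)) + g (u (simplex_vertex 1))) \<and> g x0 = 0" if U: "U \<in> \<U>" for U
  proof -
    obtain g where g: "\<And>u. singular_simplex 1 (subtopology X U) u \<Longrightarrow>
          c u = g (u (simplex_vertex 0)) + g (u (simplex_vertex 1))"
      using exact_on_contractible[OF cocycle_1_subtopology[OF c, of U] contr[OF U]] unfolding exact_on_def by auto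
    have eq: "(a + x) + (b + x) = a + b" for a b x :: bit
      by (cases x; cases a; cases b; simp)
    \<comment> \<open>Adding a constant does not affect differences, so the primitive can be
      normalized at \<open>x0\<close>.\<close>
    show ?thesis
      by (rule exI[of _ "\<lambda>x. g x + g x0"]) (use g in \<open>simp add: eq bit_add_self\<close>)
  qed
  then obtain g where g: "\<And>U u. U \<in> \<U> \<Longrightarrow> singular_simplex 1 (subtopology X U) u \<Longrightarrow>
          c u = g U (u (simplex_vertex 0)) + g U (u (simplex_vertex 1))"
      and g0: "\<And>U. U \<in> \<U> \<Longrightarrow> g U x0 = 0"
    by metis
  \<comment> \<open>Along a path from \<open>x0\<close> to \<open>x\<close> inside the overlap, both
    primitives measure the same value of \<open>c\<close> and start from 0.\<close>
  have agree: "g U x = g V x" if UV: "U \<in> \<U>" "V \<in> \<U>" "x \<in> U" "x \<in> V" for U V x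
  proof -
    obtain u where u: "singular_simplex 1 (subtopology X (U \<inter> V)) u"
        "u (simplex_vertex 0) = x0" "u (simplex_vertex 1) = x"
      using path_simplex[OF conn[OF UV(1,2)], of x0 x] base UV by blast
    then have "singular_simplex 1 (subtopology X U) u" "singular_simplex 1 (subtopology X V) u"
      by (auto simp: singular_simplex_subtopology)
    then show ?thesis
      using g[OF that(1)] g[OF that(2)] u g0 that by (metis add_0)
  qed
  define G where "G x = g (SOME U. U \<in> \<U> \<and> x \<in> U) x" for x
  have G: "G x = g U x" if "U \<in> \<U>" "x \<in> U" for U x
    unfolding G_def using that by (metis (mono_tags, lifting) agree someI)
  have "c u = G (u (simplex_vertex 0)) + G (u (simplex_vertex 1))" if u: "singular_simplex 1 X u" for u
  proof -
    obtain \<gamma> :: "real \<Rightarrow> _" where \<gamma>: "continuous_map (top_of_set {0..1}) X \<gamma>" "affine_edge \<gamma> 0 1 = u"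
        "\<gamma> 0 = u (simplex_vertex 0)" "\<gamma> 1 = u (simplex_vertex 1)"
      by (rule singular_simplex_as_affine_edge[OF u])
    \<comment> \<open>Bisection: the claim holds on short pieces, which lie in one member of the
      cover, and adds up over adjacent ones. The guard is there because the local case of
      \<open>Bolzano\<close> also offers intervals that leave the unit interval.\<close>
    define P where "P a b \<longleftrightarrow> (0 \<le> a \<and> b \<le> 1 \<longrightarrow> c (affine_edge \<gamma> a b) = G (\<gamma> a) + G (\<gamma> b))" for a b
    have "(0::real) \<le> 1" by simp
    then have "P 0 1"
    proof (induction rule: Bolzano)
      case (trans a b d)
      have eq: "(x + y) + (y + z) = x + z" for x y z :: bit
        by (cases x; cases y; cases z; simp)
      from trans show ?case
        using cocycle_affine_edge[OF c \<gamma>(1), of a b d] by (auto simp: P_def eq)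
    next
      case (local x)
      then have "\<gamma> x \<in> topspace X"
        using \<gamma>(1) by (auto simp: continuous_map_def)
      then obtain U where U: "U \<in> \<U>" "\<gamma> x \<in> U"
        using cover by auto
      have "openin (top_of_set {0..1}) {t \<in> {0..1}. \<gamma> t \<in> U}"
        using openin_continuous_map_preimage[OF \<gamma>(1) opn[OF U(1)]] by simp
      then obtain e where e: "e > 0" "\<And>t. t \<in> {0..1} \<Longrightarrow> dist t x < e \<Longrightarrow> \<gamma> t \<in> U"
        using U local unfolding openin_euclidean_subtopology_iff by fastforce
      show ?case
        unfolding P_def
      proof (intro exI conjI allI impI)
        show "e > 0" by fact
        fix a b assume ab: "a \<le> x \<and> x \<le> b \<and> b - a < e" "0 \<le> a \<and> b \<le> 1"
        have "continuous_map (top_of_set {a..b}) (subtopology X U) \<gamma>"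
          using ab continuous_map_from_subtopology_mono[OF \<gamma>(1), of "{a..b}"] e(2)
          by (auto simp: continuous_map_in_subtopology dist_real_def)
        then have "singular_simplex 1 (subtopology X U) (affine_edge \<gamma> a b)"
          using ab by (intro singular_simplex_affine_edge[of "{a..b}"]) auto
        then show "c (affine_edge \<gamma> a b) = G (\<gamma> a) + G (\<gamma> b)"
          using g[OF U(1)] G[OF U(1)] e(2) ab by (auto simp: dist_real_def)
      qed
    qed
    then show ?thesis
      by (simp add: \<gamma> P_def)
  qed
  then show ?thesis
    using c by (intro coboundaries_1_I[of c X G]) (auto simp: cocycles_def)
qed

section \<open>Faces of triangles under maps and in cup products\<close>

lemma bit_add_eq_0_iff: "a + b = 0 \<longleftrightarrow> a = (b :: bit)"
  by (cases a; cases b) auto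

lemma singular_face_simplex_map_Suc:
  assumes "k \<le> Suc p"
  shows "singular_face (Suc p) k (simplex_map (Suc p) g f) = simplex_map p g (singular_face (Suc p) k f)"
  using simplical_face_in_standard_simplex[of "Suc p" k] assms
  by (auto simp: fun_eq_iff singular_face_def simplex_map_def)

lemma singular_face_2_simplex_map:
  assumes "k \<le> 2"
  shows "singular_face 2 k (simplex_map 2 g f) = simplex_map 1 g (singular_face 2 k f)"
  using singular_face_simplex_map_Suc[of k 1 g f] assms by (simp add: numeral_2_eq_2)

lemma singular_face_2_vertex:
  "singular_face 2 0 f (simplex_vertex 0) = f (simplex_vertex 1)"
  "singular_face 2 0 f (simplex_vertex 1) = f (simplex_vertex 2)"
  "singular_face 2 1 f (simplex_vertex 0) = f (simplex_vertex 0)"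
  "singular_face 2 1 f (simplex_vertex 1) = f (simplex_vertex 2)"
  "singular_face 2 2 f (simplex_vertex 0) = f (simplex_vertex 0)"
  "singular_face 2 2 f (simplex_vertex 1) = f (simplex_vertex 1)"
  using singular_face_vertex[of 0 1 0 f] singular_face_vertex[of 0 1 1 f]
    singular_face_vertex[of 1 1 0 f] singular_face_vertex[of 1 1 1 f]
    singular_face_vertex[of 2 1 0 f] singular_face_vertex[of 2 1 1 f]
  by (simp_all add: numeral_2_eq_2)

text \<open>On the 1-simplex \<open>simplical_face 2\<close> is the identity. Together with
  \<open>back_face_1_eq\<close> this turns a cup product of 1-cochains on a triangle into a product
  of values on two faces.\<close>

lemma front_face_1_eq: "front_face 1 f = singular_face 2 2 f"
  by (auto simp: fun_eq_iff front_face_def singular_face_def simplical_face_def standard_simplex_def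
      intro!: arg_cong[of _ _ f])

lemma back_face_1_eq: "back_face 1 1 f = singular_face 2 0 f"
  by (auto simp: fun_eq_iff back_face_def singular_face_def simplical_face_def intro!: arg_cong[of _ _ f])

lemma simplex_map_vertex: "k \<le> p \<Longrightarrow> simplex_map p g f (simplex_vertex k) = g (f (simplex_vertex k))"
  by (simp add: simplex_map_def)

lemma singular_simplex_faces_2:
  assumes "singular_simplex 2 X u" "k \<le> 2"
  shows "singular_simplex 1 X (singular_face 2 k u)"
  using singular_simplex_singular_face[OF assms(1) _ assms(2)] by simp

section \<open>Orders of cohomology groups in terms of cocycles\<close>

lemma self_in_coset: "a \<in> coboundaries p X #>\<^bsub>cochain_group p X\<^esub> a"
  using zero_in_coboundaries[of p X] by (force simp: r_coset_def)

lemma coset_eq_coboundaries: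
  assumes "a \<in> coboundaries p X"
  shows "coboundaries p X #>\<^bsub>cochain_group p X\<^esub> a = coboundaries p X"
  using assms subgroup.rcos_const[OF subgroup_coboundaries group_cochain_group] by blast

lemma zero_in_cocycles: "(\<lambda>_. 0) \<in> cocycles p X"
  using coboundaries_subset_cocycles zero_in_coboundaries by blast

text \<open>Orders are preserved by isomorphisms of cohomology algebras, so the vanishing of a group
  is passed between spaces as order 1.\<close>

lemma card_cohomology_group_eq_1_iff:
  "card (carrier (cohomology_group p X)) = 1 \<longleftrightarrow> cocycles p X \<subseteq> coboundaries p X"
proof
  {
    assume "card (carrier (cohomology_group p X)) = 1"
    then obtain A where A: "carrier (cohomology_group p X) = {A}"
      by (meson card_1_singletonE)
    show "cocycles p X \<subseteq> coboundaries p X"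
    proof
      fix a assume "a \<in> cocycles p X"
      then have "coboundaries p X #>\<^bsub>cochain_group p X\<^esub> a =
          coboundaries p X #>\<^bsub>cochain_group p X\<^esub> (\<lambda>_. 0)"
        using A zero_in_cocycles[of p X] unfolding carrier_cohomology_group by blast
      then show "a \<in> coboundaries p X"
        using self_in_coset coset_eq_coboundaries[OF zero_in_coboundaries] by blast
    qed
  }
  assume "cocycles p X \<subseteq> coboundaries p X"
  then have "carrier (cohomology_group p X) = {coboundaries p X}"
    unfolding carrier_cohomology_group using coset_eq_coboundaries zero_in_cocycles[of p X] by blast
  then show "card (carrier (cohomology_group p X)) = 1"
    by simp
qed

text \<open>In degree 0 the only coboundary is the zero cochain, so the cosets are
  singletons.\<close>

lemma card_cohomology_group_0: "card (carrier (cohomology_group 0 X)) = card (cocycles 0 X)"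
proof -
  have "carrier (cohomology_group 0 X) = (\<lambda>a. {a}) ` cocycles 0 X"
    by (auto simp: carrier_cohomology_group r_coset_def)
  then show ?thesis
    by (simp add: card_image)
qed

lemma card_cohomology_group_cong:
  assumes "X \<simeq>\<^sub>2 Y"
  shows "card (carrier (cohomology_group p X)) = card (carrier (cohomology_group p Y))"
  using assms unfolding cohomology_algebras_isomorphic_def
  by (auto simp: iso_def intro: bij_betw_same_card)

text \<open>A path is a 1-simplex, and the coboundary on it is the difference of the values at its
  ends. On the empty space the two alternatives coincide.\<close>

lemma cocycle_0_path_connected:
  assumes "path_connected_space X" and a: "a \<in> cocycles 0 X"
  shows "a = (\<lambda>_. 0) \<or> a = cochain_unit X"
proof (cases "\<exists>v. singular_simplex 0 X v")
  case True
  then obtain v where v: "singular_simplex 0 X v" ..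
  have "a v' = a v" if v': "singular_simplex 0 X v'" for v'
  proof -
    have "path_connectedin X (topspace X)"
      using assms by (simp add: path_connectedin_topspace)
    then obtain u where "singular_simplex 1 (subtopology X (topspace X)) u"
        and u: "u (simplex_vertex 0) = v (simplex_vertex 0)" "u (simplex_vertex 1) = v' (simplex_vertex 0)"
      using path_simplex[of X "topspace X" "v (simplex_vertex 0)" "v' (simplex_vertex 0)"]
        singular_simplex_in_topspace[OF v] singular_simplex_in_topspace[OF v'] by auto
    then have "coboundary 0 X a u = a v + a v'"
      using coboundary_0[of X u a] singular_simplex_0_eq[OF v] singular_simplex_0_eq[OF v'] by simp
    then show ?thesis
      using a by (simp add: cocycles_def bit_add_eq_0_iff)
  qed
  moreover have "a v' = 0" if "\<not> singular_simplex 0 X v'" for v'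
    using a that by (simp add: cocycles_def carrier_cochain_group)
  ultimately show ?thesis
    by (cases "a v") (auto simp: cochain_unit_def fun_eq_iff)
next
  case False
  then show ?thesis
    using a by (auto simp: cocycles_def carrier_cochain_group fun_eq_iff)
qed

lemma cochain_unit_neq_0:
  assumes "x \<in> topspace X"
  shows "cochain_unit X \<noteq> (\<lambda>_. 0)"
  using singular_simplex_point_simplex[OF assms] by (auto simp: cochain_unit_def fun_eq_iff)

text \<open>In the theorem \<open>X\<close> is described by its cohomology algebra; this recovers
  from degree 0 that it is nonempty and, in the form needed later, connected.\<close>

lemma cocycles_0_of_card_2:
  assumes "card (cocycles 0 X) = 2"
  shows "topspace X \<noteq> {}" "cocycles 0 X = {\<lambda>_. 0, cochain_unit X}"
proof -
  show ne: "topspace X \<noteq> {}"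
  proof
    assume "topspace X = {}"
    then have "\<not> singular_simplex 0 X v" for v
      using singular_simplex_in_topspace[of 0 X v] nonempty_standard_simplex[of 0] by blast
    then have "cocycles 0 X \<subseteq> {\<lambda>_. 0}"
      by (auto simp: cocycles_def carrier_cochain_group fun_eq_iff)
    from card_mono[OF _ this] assms show False
      by simp
  qed
  then have "card {\<lambda>_. 0, cochain_unit X} = 2"
    using cochain_unit_neq_0 by fastforce
  moreover have "{\<lambda>_. 0, cochain_unit X} \<subseteq> cocycles 0 X"
    using zero_in_cocycles cochain_unit_in_cocycles by auto
  ultimately show "cocycles 0 X = {\<lambda>_. 0, cochain_unit X}"
    using assms by (metis card_subset_eq card.infinite zero_neq_numeral)
qed

section \<open>Double covers\<close>

text \<open>Local triviality is not an axiom: it follows from Hausdorff separation of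
  \<open>y\<close> and \<open>\<sigma> y\<close>, see \<open>local_section\<close>.\<close>

locale double_cover =
  fixes Y :: "'b topology" and B :: "'c topology" and \<pi> :: "'b \<Rightarrow> 'c" and \<sigma> :: "'b \<Rightarrow> 'b"
  assumes Hausdorff: "Hausdorff_space Y"
    and quotient_proj: "quotient_map Y B \<pi>"
    and continuous_deck: "continuous_map Y Y \<sigma>"
    and deck_deck: "y \<in> topspace Y \<Longrightarrow> \<sigma> (\<sigma> y) = y"
    and deck_free: "y \<in> topspace Y \<Longrightarrow> \<sigma> y \<noteq> y"
    and proj_eq_iff: "y \<in> topspace Y \<Longrightarrow> z \<in> topspace Y \<Longrightarrow> \<pi> y = \<pi> z \<longleftrightarrow> z = y \<or> z = \<sigma> y"
begin

section \<open>Local sections and uniqueness of lifts\<close>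

lemma deck_in_topspace: "y \<in> topspace Y \<Longrightarrow> \<sigma> y \<in> topspace Y"
  using continuous_deck by (auto simp: continuous_map_def)

lemma proj_deck: "y \<in> topspace Y \<Longrightarrow> \<pi> (\<sigma> y) = \<pi> y"
  using proj_eq_iff deck_in_topspace by metis

lemma continuous_proj: "continuous_map Y B \<pi>"
  using quotient_proj by (rule quotient_imp_continuous_map)

text \<open>The saturation of an open set is its union with its preimage under the involution, which
  is open.\<close>

lemma open_proj: "open_map Y B \<pi>"
  unfolding open_map_def
proof (intro allI impI)
  fix U assume U: "openin Y U"
  have "{y \<in> topspace Y. \<pi> y \<in> \<pi> ` U} = U \<union> {y \<in> topspace Y. \<sigma> y \<in> U}"
  proof (intro subset_antisym subsetI)
    fix y assume "y \<in> {y \<in> topspace Y. \<pi> y \<in> \<pi> ` U}"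
    then obtain u where "y \<in> topspace Y" "u \<in> U" "\<pi> y = \<pi> u"
      by auto
    then show "y \<in> U \<union> {y \<in> topspace Y. \<sigma> y \<in> U}"
      using proj_eq_iff[of y u] openin_subset[OF U] by auto
  next
    fix y assume "y \<in> U \<union> {y \<in> topspace Y. \<sigma> y \<in> U}"
    then show "y \<in> {y \<in> topspace Y. \<pi> y \<in> \<pi> ` U}"
      using proj_deck[of y] openin_subset[OF U] by (auto intro: rev_image_eqI)
  qed
  then have "openin Y {y \<in> topspace Y. \<pi> y \<in> \<pi> ` U}"
    using U openin_continuous_map_preimage[OF continuous_deck U] by auto
  moreover have "\<pi> ` U \<subseteq> topspace B"
    using U openin_subset continuous_map_image_subset_topspace[OF continuous_proj] by blast
  ultimately show "openin B (\<pi> ` U)"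
    using quotient_proj by (auto simp: quotient_map_def)
qed

lemma local_section:
  assumes y: "y \<in> topspace Y"
  obtains N s where "openin B N" "\<pi> y \<in> N" "continuous_map (subtopology B N) Y s"
    "\<And>b. b \<in> N \<Longrightarrow> \<pi> (s b) = b"
proof -
  obtain V V' where V: "openin Y V" "openin Y V'" "y \<in> V" "\<sigma> y \<in> V'" "disjnt V V'"
    using Hausdorff deck_free[OF y] deck_in_topspace[OF y] y unfolding Hausdorff_space_def by metis
  \<comment> \<open>Since \<open>V\<close> and \<open>V'\<close> are disjoint, \<open>W\<close>
    meets each fibre at most once. The open map \<pi> is then a homeomorphism from \<open>W\<close>
    onto its image, and its inverse is the section.\<close>
  define W where "W = V \<inter> {z \<in> topspace Y. \<sigma> z \<in> V'}"
  have W: "openin Y W" "y \<in> W" "W \<subseteq> topspace Y"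
    using V y openin_continuous_map_preimage[OF continuous_deck] openin_subset by (fastforce simp: W_def)+
  have inj: "inj_on \<pi> W"
  proof (rule inj_onI)
    fix a b assume ab: "a \<in> W" "b \<in> W" "\<pi> a = \<pi> b"
    then have "b \<noteq> \<sigma> a"
      using V by (auto simp: W_def disjnt_iff)
    then show "a = b"
      using ab W proj_eq_iff by blast
  qed
  have opW: "openin B (\<pi> ` W)"
    using open_proj W by (auto simp: open_map_def)
  have "homeomorphic_map (subtopology Y W) (subtopology B (\<pi> ` W)) \<pi>"
  proof (rule bijective_open_imp_homeomorphic_map)
    show "continuous_map (subtopology Y W) (subtopology B (\<pi> ` W)) \<pi>"
      using continuous_proj by (auto simp: continuous_map_in_subtopology continuous_map_from_subtopology)
    show "open_map (subtopology Y W) (subtopology B (\<pi> ` W)) \<pi>"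
      using open_proj W opW by (auto simp: open_map_def openin_open_subtopology)
  qed (use inj W openin_subset[OF opW] in \<open>auto simp: inj_on_def\<close>)
  then obtain s where s: "homeomorphic_maps (subtopology Y W) (subtopology B (\<pi> ` W)) \<pi> s"
    unfolding homeomorphic_map_maps by blast
  show thesis
  proof (rule that[OF opW])
    show "continuous_map (subtopology B (\<pi> ` W)) Y s"
      using s by (auto simp: homeomorphic_maps_def continuous_map_in_subtopology)
    show "\<pi> (s b) = b" if "b \<in> \<pi> ` W" for b
      using s that openin_subset[OF opW] by (auto simp: homeomorphic_maps_def)
  qed (use W in auto)
qed

text \<open>The two coincidence sets are closed because \<open>Y\<close> is Hausdorff, disjoint
  because the involution has no fixed points, and they cover \<open>T\<close>; connectedness leaves
  only one of them.\<close>

lemma lift_unique: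
  assumes "connected_space T" and h: "continuous_map T Y h" and k: "continuous_map T Y k"
    and eq: "\<And>x. x \<in> topspace T \<Longrightarrow> \<pi> (h x) = \<pi> (k x)"
  shows "(\<forall>x \<in> topspace T. k x = h x) \<or> (\<forall>x \<in> topspace T. k x = \<sigma> (h x))"
proof -
  let ?A = "{x \<in> topspace T. k x = h x}" and ?C = "{x \<in> topspace T. k x = \<sigma> (h x)}"
  have "continuous_map T Y (\<sigma> \<circ> h)"
    using h continuous_deck continuous_map_compose by blast
  then have "closedin T ?A" "closedin T ?C"
    using closedin_continuous_maps_eq[OF Hausdorff] h k by (auto simp: o_def)
  moreover have hk: "h x \<in> topspace Y" "k x \<in> topspace Y" if "x \<in> topspace T" for x
    using that h k by (auto simp: continuous_map_def)
  have "topspace T \<subseteq> ?A \<union> ?C"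
    using eq hk proj_eq_iff by blast
  moreover have "?A \<inter> ?C = {}"
    using hk deck_free by auto
  ultimately have "?A = {} \<or> ?C = {}"
    using assms(1) unfolding connected_space_closedin by blast
  then show ?thesis
    using \<open>topspace T \<subseteq> ?A \<union> ?C\<close> by blast
qed

section \<open>Lifting squares and triangles\<close>

definition lifts_on :: "'e::metric_space set \<Rightarrow> ('e \<Rightarrow> 'c) \<Rightarrow> bool" where
  "lifts_on S F \<longleftrightarrow> (\<exists>h. continuous_map (top_of_set S) Y h \<and> (\<forall>x\<in>S. \<pi> (h x) = F x))"

lemma lifts_on_subset: "lifts_on S F \<Longrightarrow> T \<subseteq> S \<Longrightarrow> lifts_on T F"
  unfolding lifts_on_def by (meson continuous_map_from_subtopology_mono subsetD)

text \<open>On the connected overlap the two lifts agree up to the involution, which is absorbed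
  into the second lift before pasting.\<close>

lemma lifts_on_Un:
  assumes "lifts_on S F" "lifts_on T F" "connected (S \<inter> T)" "closed S" "closed T"
  shows "lifts_on (S \<union> T) F"
proof -
  obtain h k where h: "continuous_map (top_of_set S) Y h" "\<And>x. x \<in> S \<Longrightarrow> \<pi> (h x) = F x"
    and k: "continuous_map (top_of_set T) Y k" "\<And>x. x \<in> T \<Longrightarrow> \<pi> (k x) = F x"
    using assms unfolding lifts_on_def by blast
  have hT: "\<And>x. x \<in> S \<Longrightarrow> h x \<in> topspace Y" and kT: "\<And>x. x \<in> T \<Longrightarrow> k x \<in> topspace Y"
    using h k by (auto simp: continuous_map_def)
  have "connected_space (top_of_set (S \<inter> T))"
    using assms(3) connectedin_iff_connected[of "S \<inter> T"] by (simp add: connectedin_def del: connectedin_iff_connected)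
  then have "(\<forall>x \<in> S \<inter> T. k x = h x) \<or> (\<forall>x \<in> S \<inter> T. k x = \<sigma> (h x))"
    using lift_unique[of "top_of_set (S \<inter> T)" h k] assms h k
      continuous_map_from_subtopology_mono[OF h(1), of "S \<inter> T"]
      continuous_map_from_subtopology_mono[OF k(1), of "S \<inter> T"]
    by simp
  then obtain k' where k': "continuous_map (top_of_set T) Y k'" "\<And>x. x \<in> T \<Longrightarrow> \<pi> (k' x) = F x"
    and agree: "\<And>x. x \<in> S \<inter> T \<Longrightarrow> k' x = h x"
  proof
    assume "\<forall>x \<in> S \<inter> T. k x = \<sigma> (h x)"
    moreover have "continuous_map (top_of_set T) Y (\<sigma> \<circ> k)"
      using k continuous_deck continuous_map_compose by blast
    ultimately show thesis
      using k hT kT by (intro that[of "\<sigma> \<circ> k"]) (auto simp: proj_deck deck_deck)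
  qed (use k in blast)
  let ?g = "\<lambda>x. if x \<in> S then h x else k' x"
  have "continuous_map (top_of_set (S \<union> T)) Y ?g"
  proof (rule pasting_lemma_closed[where I = "{True, False}" and T = "\<lambda>b. if b then S else T"
        and f = "\<lambda>b. if b then h else k'"])
    show "closedin (top_of_set (S \<union> T)) (if b then S else T)" for b
      using assms by (auto intro!: closed_subset)
    show "continuous_map (subtopology (top_of_set (S \<union> T)) (if b then S else T)) Y
        (if b then h else k')" for b
      using h k' by (auto simp: subtopology_subtopology Int_absorb1)
  qed (use agree in auto)
  moreover have "\<pi> (?g x) = F x" if "x \<in> S \<union> T" for x
    using that h k' by auto
  ultimately show ?thesis
    unfolding lifts_on_def by blast
qed

lemma lifts_on_locally:
  assumes F: "continuous_map (top_of_set S) B F" and x: "x \<in> S"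
  obtains e where "e > 0" "lifts_on (S \<inter> ball x e) F"
proof -
  have "F x \<in> topspace B"
    using F x by (auto simp: continuous_map_def)
  then obtain y where y: "y \<in> topspace Y" "\<pi> y = F x"
    using quotient_imp_surjective_map[OF quotient_proj] by force
  obtain N s where N: "openin B N" "F x \<in> N" and s: "continuous_map (subtopology B N) Y s"
      "\<And>b. b \<in> N \<Longrightarrow> \<pi> (s b) = b"
    using local_section[OF y(1)] y(2) by metis
  have "openin (top_of_set S) {t \<in> S. F t \<in> N}"
    using openin_continuous_map_preimage[OF F N(1)] by simp
  then obtain e where e: "e > 0" "\<And>t. t \<in> S \<Longrightarrow> dist t x < e \<Longrightarrow> F t \<in> N"
    using N(2) x unfolding openin_euclidean_subtopology_iff by fastforce
  have "continuous_map (top_of_set (S \<inter> ball x e)) (subtopology B N) F"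
    using continuous_map_from_subtopology_mono[OF F, of "S \<inter> ball x e"] e(2)
    by (auto simp: continuous_map_in_subtopology dist_commute)
  then have "continuous_map (top_of_set (S \<inter> ball x e)) Y (s \<circ> F)"
    using s(1) continuous_map_compose by blast
  moreover have "\<forall>t \<in> S \<inter> ball x e. \<pi> ((s \<circ> F) t) = F t"
    using s(2) e(2) by (auto simp: dist_commute)
  ultimately show thesis
    using that[OF e(1)] unfolding lifts_on_def by blast
qed

text \<open>Two nested bisections: a vertical one yields a lift over a strip around each
  \<open>x\<close>, and a horizontal one joins the strips.\<close>

lemma lifts_on_unit_square:
  fixes F :: "real \<times> real \<Rightarrow> 'c"
  assumes F: "continuous_map (top_of_set ({0..1} \<times> {0..1})) B F"
  shows "lifts_on ({0..1} \<times> {0..1}) F"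
proof -
  define I where "I x d = {x - d..x + d} \<inter> {0..1::real}" for x d :: real
  have strip: "\<exists>d>0. lifts_on (I x d \<times> {0..1}) F" if x: "0 \<le> x" "x \<le> 1" for x
  proof -
    \<comment> \<open>The half-width \<open>d\<close> is quantified inside \<open>P\<close>, so that
      two stacked boxes can be cut to the smaller width; they then meet in a horizontal segment,
      which is connected.\<close>
    define P where "P a b \<longleftrightarrow> (0 \<le> a \<and> b \<le> 1 \<longrightarrow> (\<exists>d>0. lifts_on (I x d \<times> {a..b}) F))" for a b :: real
    have "(0::real) \<le> 1" by simp
    then have "P 0 1"
    proof (induction rule: Bolzano)
      case (trans a b c)
      show ?case
        unfolding P_def
      proof
        assume "0 \<le> a \<and> c \<le> 1"
        with trans obtain d e where d: "d > 0" "lifts_on (I x d \<times> {a..b}) F"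
          and e: "e > 0" "lifts_on (I x e \<times> {b..c}) F"
          unfolding P_def by auto
        let ?d = "min d e"
        have "lifts_on (I x ?d \<times> {a..b} \<union> I x ?d \<times> {b..c}) F"
        proof (rule lifts_on_Un)
          show "lifts_on (I x ?d \<times> {a..b}) F" "lifts_on (I x ?d \<times> {b..c}) F"
            by (rule lifts_on_subset[OF d(2)] lifts_on_subset[OF e(2)]; force simp: I_def)+
          have "I x ?d \<times> {a..b} \<inter> I x ?d \<times> {b..c} = I x ?d \<times> {b}"
            using trans by auto
          moreover have "connected (I x ?d \<times> {b})"
            unfolding I_def by (intro convex_connected convex_Times convex_Int) auto
          ultimately show "connected (I x ?d \<times> {a..b} \<inter> I x ?d \<times> {b..c})"
            by simp
        qed (auto simp: I_def intro!: closed_Times closed_Int)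
        moreover have "I x ?d \<times> {a..b} \<union> I x ?d \<times> {b..c} = I x ?d \<times> {a..c}"
          using trans by auto
        ultimately show "\<exists>d>0. lifts_on (I x d \<times> {a..c}) F"
          using d e by (metis min_less_iff_conj)
      qed
    next
      case (local y)
      then obtain e where e: "e > 0" "lifts_on (({0..1} \<times> {0..1}) \<inter> ball (x, y) e) F"
        using lifts_on_locally[OF F, of "(x, y)"] x by auto
      show ?case
        unfolding P_def
      proof (intro exI[of _ "e / 2"] conjI allI impI)
        fix a b assume ab: "a \<le> y \<and> y \<le> b \<and> b - a < e / 2" "0 \<le> a \<and> b \<le> 1"
        \<comment> \<open>The Euclidean distance is at most the sum of the coordinate distances,
          hence \<open>e / 2\<close> in each direction.\<close>
        have "dist (x, y) (x', y') < e" if "x' \<in> I x (e / 2)" "y' \<in> {a..b}" for x' y'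
        proof -
          have "dist (x, y) (x', y') \<le> \<bar>x - x'\<bar> + \<bar>y - y'\<bar>"
            using sqrt_sum_squares_le_sum_abs by (simp add: dist_Pair_Pair dist_real_def)
          also have "\<dots> < e"
            using that ab by (auto simp: I_def)
          finally show ?thesis .
        qed
        then have "I x (e / 2) \<times> {a..b} \<subseteq> ({0..1} \<times> {0..1}) \<inter> ball (x, y) e"
          using ab by (auto simp: I_def)
        then show "lifts_on (I x (e / 2) \<times> {a..b}) F"
          using e(2) lifts_on_subset by blast
      qed (use e in auto)
    qed
    then show ?thesis
      by (simp add: P_def)
  qed
  define P where "P a b \<longleftrightarrow> (0 \<le> a \<and> b \<le> 1 \<longrightarrow> lifts_on ({a..b} \<times> {0..1}) F)" for a b :: real
  have "(0::real) \<le> 1" by simp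
  then have "P 0 1"
  proof (induction rule: Bolzano)
    case (trans a b c)
    show ?case
      unfolding P_def
    proof
      assume "0 \<le> a \<and> c \<le> 1"
      with trans have "lifts_on ({a..b} \<times> {0..1} \<union> {b..c} \<times> {0..1}) F"
        by (intro lifts_on_Un)
           (auto simp: P_def Times_Int_Times intro!: closed_Times convex_connected convex_Times convex_Int)
      moreover have "{a..b} \<times> {0..1} \<union> {b..c} \<times> {0..1::real} = {a..c} \<times> {0..1}"
        using trans by auto
      ultimately show "lifts_on ({a..c} \<times> {0..1}) F"
        by simp
    qed
  next
    case (local x)
    then obtain d where d: "d > 0" "lifts_on (I x d \<times> {0..1}) F"
      using strip by blast
    show ?case
      unfolding P_def
    proof (intro exI[of _ d] conjI allI impI)
      fix a b assume "a \<le> x \<and> x \<le> b \<and> b - a < d" "0 \<le> a \<and> b \<le> 1"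
      then show "lifts_on ({a..b} \<times> {0..1}) F"
        by (intro lifts_on_subset[OF d(2)]) (auto simp: I_def)
    qed (use d in auto)
  qed
  then show ?thesis
    by (simp add: P_def)
qed

text \<open>A simplex that is a retract of the square inherits lifting from it: the lift of
  \<open>f \<circ> \<rho>\<close> is restricted along \<iota>.\<close>

lemma lift_simplex_retract:
  fixes \<rho> :: "real \<times> real \<Rightarrow> nat \<Rightarrow> real"
  assumes f: "singular_simplex p B f"
    and "continuous_on ({0..1} \<times> {0..1}) \<rho>" "\<rho> ` ({0..1} \<times> {0..1}) \<subseteq> standard_simplex p"
    and "continuous_on (standard_simplex p) \<iota>" "\<iota> ` standard_simplex p \<subseteq> {0..1} \<times> {0..1}"
    and "\<And>t. t \<in> standard_simplex p \<Longrightarrow> \<rho> (\<iota> t) = t"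
  obtains u where "singular_simplex p Y u" "f = simplex_map p \<pi> u"
proof -
  have "continuous_map (top_of_set ({0..1} \<times> {0..1})) (top_of_set (standard_simplex p)) \<rho>"
    using assms by (auto simp: continuous_map_in_subtopology)
  moreover have "continuous_map (top_of_set (standard_simplex p)) B f"
    using f unfolding singular_simplex_def euclidean_product_topology by auto
  ultimately have "continuous_map (top_of_set ({0..1} \<times> {0..1})) B (f \<circ> \<rho>)"
    using continuous_map_compose by blast
  then have "lifts_on ({0..1} \<times> {0..1}) (f \<circ> \<rho>)"
    by (rule lifts_on_unit_square)
  then obtain h where h: "continuous_map (top_of_set ({0..1} \<times> {0..1})) Y h"
      "\<And>x. x \<in> {0..1} \<times> {0..1} \<Longrightarrow> \<pi> (h x) = f (\<rho> x)"
    unfolding lifts_on_def o_def by metis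
  have fe: "f \<in> extensional (standard_simplex p)"
    using f by (simp add: singular_simplex_def)
  show thesis
  proof (rule that[of "restrict (\<lambda>t. h (\<iota> t)) (standard_simplex p)"])
    show "singular_simplex p Y (restrict (\<lambda>t. h (\<iota> t)) (standard_simplex p))"
      using assms by (intro singular_simplex_restrict[OF h(1)]) auto
    show "f = simplex_map p \<pi> (restrict (\<lambda>t. h (\<iota> t)) (standard_simplex p))"
    proof
      fix t show "f t = simplex_map p \<pi> (restrict (\<lambda>t. h (\<iota> t)) (standard_simplex p)) t"
        using assms h(2)[of "\<iota> t"] fe by (cases "t \<in> standard_simplex p") (auto simp: simplex_map_def extensional_def)
    qed
  qed
qed

lemma lift_2_simplex:
  assumes "singular_simplex 2 B f"
  obtains u where "singular_simplex 2 Y u" "f = simplex_map 2 \<pi> u"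
proof -
  \<comment> \<open>The square is retracted onto the triangle \<open>x + y \<le> 1\<close> by
    cutting \<open>x\<close> down to at most \<open>1 - y\<close>; the entries are barycentric
    coordinates.\<close>
  define \<rho> :: "real \<times> real \<Rightarrow> nat \<Rightarrow> real" where
    "\<rho> = (\<lambda>x i. if i = 0 then 1 - min (fst x) (1 - snd x) - snd x
                 else if i = 1 then min (fst x) (1 - snd x) else if i = 2 then snd x else 0)"
  show thesis
  proof (rule lift_simplex_retract[OF assms, where \<rho> = \<rho> and \<iota> = "\<lambda>t. (t 1, t 2)"])
    show "continuous_on ({0..1} \<times> {0..1}) \<rho>"
    proof (rule continuous_on_coordinatewise_then_product)
      show "continuous_on ({0..1} \<times> {0..1}) (\<lambda>x. \<rho> x i)" for i
        unfolding \<rho>_def by (cases "i = 0"; cases "i = 1"; cases "i = 2") (auto intro!: continuous_intros)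
    qed
    show "\<rho> ` ({0..1} \<times> {0..1}) \<subseteq> standard_simplex 2"
      by (auto simp: standard_simplex_def \<rho>_def numeral_2_eq_2)
    show "(\<lambda>t::nat\<Rightarrow>real. (t 1, t 2)) ` standard_simplex 2 \<subseteq> {0..1} \<times> {0..1::real}"
      by (auto simp: standard_simplex_def)
    show "\<rho> (t 1, t 2) = t" if "t \<in> standard_simplex 2" for t
    proof
      fix i
      have t: "0 \<le> t 0" "t 0 + t 1 + t 2 = 1" "\<forall>i>2. t i = 0"
        using standard_simplex_2_D[OF that] that by (auto simp: standard_simplex_def)
      then have "min (t 1) (1 - t 2) = t 1"
        by linarith
      with t show "\<rho> (t 1, t 2) i = t i"
        by (cases "i = 0"; cases "i = 1"; cases "i = 2") (auto simp: \<rho>_def)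
    qed
  qed (use that in \<open>auto intro!: continuous_intros continuous_on_coordinate\<close>)
qed

end

section \<open>The characteristic cocycle of a double cover\<close>

context double_cover begin

text \<open>The function marks one chosen point in every fibre. It need not be continuous, because
  any function on points is a 0-cochain.\<close>

lemma orientation_exists: "\<exists>\<epsilon> :: 'b \<Rightarrow> bit. \<forall>y \<in> topspace Y. \<epsilon> (\<sigma> y) = \<epsilon> y + 1"
proof -
  define s where "s b = (SOME z. z \<in> topspace Y \<and> \<pi> z = b)" for b
  have "s (\<pi> y) = y \<or> s (\<pi> y) = \<sigma> y" if "y \<in> topspace Y" for y
  proof -
    have "s (\<pi> y) \<in> topspace Y \<and> \<pi> (s (\<pi> y)) = \<pi> y"
      unfolding s_def by (rule someI[of _ y]) (use that in simp)
    then show ?thesis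
      using that proj_eq_iff by metis
  qed
  then show ?thesis
    by (intro exI[of _ "\<lambda>y. if y = s (\<pi> y) then 1 else 0"]) (auto simp: proj_deck deck_free dest: sym)
qed

definition orientation :: "'b \<Rightarrow> bit" where
  "orientation = (SOME \<epsilon>. \<forall>y \<in> topspace Y. \<epsilon> (\<sigma> y) = \<epsilon> y + 1)"

lemma orientation_deck: "y \<in> topspace Y \<Longrightarrow> orientation (\<sigma> y) = orientation y + 1"
  using someI_ex[OF orientation_exists] unfolding orientation_def by blast

text \<open>This represents the class classifying the double cover. The lift of \<open>f\<close> is
  chosen arbitrarily; \<open>characteristic_cochain_proj\<close> shows that every lift gives the
  same value.\<close>

definition characteristic_cochain :: "((nat \<Rightarrow> real) \<Rightarrow> 'c) \<Rightarrow> bit" where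
  "characteristic_cochain f =
     (if singular_simplex 1 B f then
        let u = SOME u. singular_simplex 1 Y u \<and> f = simplex_map 1 \<pi> u
        in orientation (u (simplex_vertex 0)) + orientation (u (simplex_vertex 1))
      else 0)"

text \<open>Two lifts of an edge coincide or are exchanged by the involution. In the second case the
  orientation changes by 1 at both ends, and the changes cancel.\<close>

lemma characteristic_cochain_proj:
  assumes u: "singular_simplex 1 Y u"
  shows "characteristic_cochain (simplex_map 1 \<pi> u) =
    orientation (u (simplex_vertex 0)) + orientation (u (simplex_vertex 1))"
proof -
  let ?P = "\<lambda>v. singular_simplex 1 Y v \<and> simplex_map 1 \<pi> u = simplex_map 1 \<pi> v"
  define v where "v = (SOME v. ?P v)"
  have v: "?P v"
    unfolding v_def by (rule someI[of ?P u]) (use u in simp)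
  have "continuous_map (top_of_set (standard_simplex 1)) Y u"
       "continuous_map (top_of_set (standard_simplex 1)) Y v"
    using u v unfolding singular_simplex_def euclidean_product_topology by auto
  moreover have "connected_space (top_of_set (standard_simplex 1))"
    using connectedin_standard_simplex[of 1] unfolding connectedin_def euclidean_product_topology by simp
  moreover have "\<pi> (u t) = \<pi> (v t)" if "t \<in> standard_simplex 1" for t
    using v that by (metis (no_types, lifting) comp_apply restrict_apply' simplex_map_def)
  ultimately have "(\<forall>t \<in> standard_simplex 1. v t = u t) \<or> (\<forall>t \<in> standard_simplex 1. v t = \<sigma> (u t))"
    using lift_unique[of "top_of_set (standard_simplex 1)" u v] by simp
  then have "orientation (v (simplex_vertex 0)) + orientation (v (simplex_vertex 1)) =
     orientation (u (simplex_vertex 0)) + orientation (u (simplex_vertex 1))"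
  proof
    have eq: "(a + 1) + (b + 1) = a + b" for a b :: bit
      by (cases a; cases b) simp_all
    assume "\<forall>t \<in> standard_simplex 1. v t = \<sigma> (u t)"
    then show ?thesis
      using u by (simp add: orientation_deck singular_simplex_in_topspace eq)
  qed simp
  moreover have "singular_simplex 1 B (simplex_map 1 \<pi> u)"
    using u continuous_proj singular_simplex_simplex_map by blast
  ultimately show ?thesis
    unfolding characteristic_cochain_def v_def[symmetric] Let_def by simp
qed

text \<open>After lifting the triangle, its edges are projections of the edges upstairs, and the
  orientation of each vertex occurs twice in the sum.\<close>

lemma characteristic_cochain_cocycle: "characteristic_cochain \<in> cocycles 1 B"
  unfolding cocycle_1_iff
proof (intro conjI allI impI)
  show "characteristic_cochain \<in> carrier (cochain_group 1 B)"
    by (simp add: carrier_cochain_group characteristic_cochain_def)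
  fix F assume "singular_simplex 2 B F"
  then obtain u where u: "singular_simplex 2 Y u" "F = simplex_map 2 \<pi> u"
    using lift_2_simplex by blast
  have eq: "(b + c) + (a + c) + (a + b) = 0" for a b c :: bit
    by (cases a; cases b; cases c) simp_all
  show "characteristic_cochain (singular_face 2 0 F) + characteristic_cochain (singular_face 2 1 F) +
      characteristic_cochain (singular_face 2 2 F) = 0"
    unfolding u(2)
    by (simp only: singular_face_2_simplex_map[OF le0] singular_face_2_simplex_map[OF order_refl]
        singular_face_2_simplex_map[OF one_le_numeral]
        characteristic_cochain_proj singular_simplex_faces_2[OF u(1)]
        singular_face_2_vertex order_refl le0 one_le_numeral eq)
qed

section \<open>The obstruction to an equivariant map\<close>

theorem no_equivariant_map:
  assumes trivial: "cocycles 2 B \<subseteq> coboundaries 2 B"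
    and H0: "cocycles 0 X = {\<lambda>_. 0, cochain_unit X}" and H1: "cocycles 1 X \<subseteq> coboundaries 1 X"
    and "topspace X \<noteq> {}"
    and \<tau>: "continuous_map X X \<tau>" "\<And>x. x \<in> topspace X \<Longrightarrow> \<tau> (\<tau> x) = x"
    and f: "continuous_map X Y f" and equi: "\<And>x. x \<in> topspace X \<Longrightarrow> f (\<tau> x) = \<sigma> (f x)"
  shows False
proof -
  let ?w = characteristic_cochain
  define e where "e x = orientation (f x)" for x
  have fY: "f x \<in> topspace Y" and \<tau>X: "\<tau> x \<in> topspace X" if "x \<in> topspace X" for x
    using f \<tau>(1) that by (auto simp: continuous_map_def)
  have e\<tau>: "e (\<tau> x) = e x + 1" if "x \<in> topspace X" for x
    using that by (simp add: e_def equi orientation_deck fY)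
  have "cochain_cup 1 1 B ?w ?w \<in> cocycles 2 B"
    using cochain_cup_in_cocycles[OF characteristic_cochain_cocycle characteristic_cochain_cocycle]
    by (simp add: numeral_2_eq_2)
  \<comment> \<open>Writing the degree as a successor exposes a primitive of the cup square.\<close>
  then have "cochain_cup 1 1 B ?w ?w \<in> coboundaries (Suc 1) B"
    using trivial by (auto simp: numeral_2_eq_2)
  then obtain c where c: "cochain_cup 1 1 B ?w ?w = coboundary 1 B c"
    by auto
  \<comment> \<open>On an edge, the second summand is \<open>e \<union> \<delta> e\<close>. Its
    coboundary \<open>\<delta> e \<union> \<delta> e\<close> is the pullback of
    \<open>w \<union> w\<close>, and so cancels that of the first summand. The value 0 elsewhere
    makes \<open>d\<close> a cochain.\<close>
  define d where "d u = (if singular_simplex 1 X u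
      then c (simplex_map 1 (\<pi> \<circ> f) u) +
           e (u (simplex_vertex 0)) * (e (u (simplex_vertex 0)) + e (u (simplex_vertex 1)))
      else 0)" for u
  have "d \<in> cocycles 1 X"
    unfolding cocycle_1_iff
  proof (intro conjI allI impI)
    show "d \<in> carrier (cochain_group 1 X)"
      by (simp add: carrier_cochain_group d_def)
    fix U assume U: "singular_simplex 2 X U"
    \<comment> \<open>The triangle is followed to \<open>Y\<close>, where the characteristic cochain
      is expressed by \<open>orientation\<close>, and then to the base, where \<open>c\<close> is
      evaluated.\<close>
    define V where "V = simplex_map 2 f U"
    define F where "F = simplex_map 2 \<pi> V"
    have V: "singular_simplex 2 Y V"
      unfolding V_def by (rule singular_simplex_simplex_map[OF U f])
    have F: "singular_simplex 2 B F"
      unfolding F_def by (rule singular_simplex_simplex_map[OF V continuous_proj])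
    have faceF: "singular_face 2 k F = simplex_map 1 (\<pi> \<circ> f) (singular_face 2 k U)" if "k \<le> 2" for k
      unfolding F_def V_def using that by (simp add: singular_face_2_simplex_map simplex_map_compose)
    have wF: "?w (singular_face 2 k F) = orientation (singular_face 2 k V (simplex_vertex 0)) +
        orientation (singular_face 2 k V (simplex_vertex 1))" if "k \<le> 2" for k
      unfolding F_def using that
      by (simp add: singular_face_2_simplex_map characteristic_cochain_proj singular_simplex_faces_2[OF V] del: One_nat_def)
    have eV: "orientation (V (simplex_vertex k)) = e (U (simplex_vertex k))" if "k \<le> 2" for k
      using that by (simp add: V_def e_def simplex_map_vertex)
    let ?e = "\<lambda>k. e (U (simplex_vertex k))"
    have "c (singular_face 2 0 F) + c (singular_face 2 1 F) + c (singular_face 2 2 F) =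
        coboundary 1 B c F"
      using coboundary_1[OF F, of c] by simp
    also have "\<dots> = ?w (front_face 1 F) * ?w (back_face 1 1 F)"
      unfolding c[symmetric] cochain_cup_def using F by (simp add: numeral_2_eq_2)
    also have "\<dots> = (?e 0 + ?e 1) * (?e 1 + ?e 2)"
      unfolding front_face_1_eq back_face_1_eq
      by (simp only: wF order_refl le0 singular_face_2_vertex eV one_le_numeral)
    finally have *: "c (singular_face 2 0 F) + c (singular_face 2 1 F) + c (singular_face 2 2 F) =
        (?e 0 + ?e 1) * (?e 1 + ?e 2)" .
    \<comment> \<open>Here \<open>a\<close>, \<open>b\<close>, \<open>c\<close> stand for the values
      of \<open>e\<close> at the three vertices; the summands from
      \<open>e \<union> \<delta> e\<close> add up to \<open>(a + b) * (b + c)\<close>.\<close>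
    have eq: "x + b * (b + c) + (y + a * (a + c)) + (z + a * (a + b)) = 0"
      if "x + y + z = (a + b) * (b + c)" for x y z a b c :: bit
      using that by (cases a; cases b; cases c; cases x; cases y; cases z) simp_all
    have dF: "d (singular_face 2 k U) = c (singular_face 2 k F) +
       e (singular_face 2 k U (simplex_vertex 0)) *
        (e (singular_face 2 k U (simplex_vertex 0)) + e (singular_face 2 k U (simplex_vertex 1)))"
      if "k \<le> 2" for k
      using that by (simp add: d_def singular_simplex_faces_2[OF U that] faceF del: One_nat_def)
    show "d (singular_face 2 0 U) + d (singular_face 2 1 U) + d (singular_face 2 2 U) = 0"
      by (simp only: dF order_refl le0 one_le_numeral singular_face_2_vertex eq[OF *])
  qed
  then obtain g where g: "\<And>u. singular_simplex 1 X u \<Longrightarrow>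
      d u = g (u (simplex_vertex 0)) + g (u (simplex_vertex 1))"
    using H1 coboundaries_1_E[of d X] by blast
  define k where "k v = (if singular_simplex 0 X v then
      g (v (simplex_vertex 0)) + g (\<tau> (v (simplex_vertex 0))) + e (v (simplex_vertex 0)) else 0)" for v
  have kpt: "k (point_simplex x) = g x + g (\<tau> x) + e x" if "x \<in> topspace X" for x
    using that by (simp add: k_def singular_simplex_point_simplex)
  have "coboundary 0 X k u = 0" for u
  proof (cases "singular_simplex 1 X u")
    case u: True
    let ?x = "u (simplex_vertex 0)" and ?y = "u (simplex_vertex 1)"
    have xy: "?x \<in> topspace X" "?y \<in> topspace X"
      using u by (auto intro: singular_simplex_in_topspace)
    let ?u = "simplex_map 1 \<tau> u"
    have \<tau>u: "singular_simplex 1 X ?u"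
      using u \<tau>(1) by (rule singular_simplex_simplex_map)
    \<comment> \<open>As \<open>\<pi> \<circ> f\<close> is invariant under \<tau>, the contributions
      of \<open>c\<close> to an edge and to its translate are equal and will cancel.\<close>
    have "simplex_map 1 (\<pi> \<circ> f) ?u = simplex_map 1 (\<pi> \<circ> f) u"
      using singular_simplex_in_topspace[OF u] by (auto simp: simplex_map_def fun_eq_iff equi proj_deck fY)
    then have "g (\<tau> ?x) + g (\<tau> ?y) = c (simplex_map 1 (\<pi> \<circ> f) u) + (e ?x + 1) * ((e ?x + 1) + (e ?y + 1))"
      using g[OF \<tau>u] \<tau>u xy by (simp add: d_def simplex_map_vertex e\<tau>)
    moreover have "g ?x + g ?y = c (simplex_map 1 (\<pi> \<circ> f) u) + e ?x * (e ?x + e ?y)"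
      using g[OF u] u by (simp add: d_def)
    \<comment> \<open>What remains is \<open>p * (p + q) + (p + 1) * (p + q) = p + q\<close>, the
      change of \<open>e\<close> along the edge.\<close>
    moreover have "a + a' + p + (b + b' + q) = 0"
      if "a' + b' = z + (p + 1) * ((p + 1) + (q + 1))" "a + b = z + p * (p + q)" for a a' b b' p q z :: bit
      using that by (cases a; cases b; cases a'; cases b'; cases p; cases q; cases z) simp_all
    ultimately show ?thesis
      unfolding coboundary_0[OF u] kpt[OF xy(1)] kpt[OF xy(2)] by blast
  qed (simp add: coboundary_def)
  then have "k \<in> cocycles 0 X"
    by (simp add: cocycles_def fun_eq_iff carrier_cochain_group k_def)
  then have k: "k = (\<lambda>_. 0) \<or> k = cochain_unit X"
    using H0 by auto
  obtain x where x: "x \<in> topspace X"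
    using \<open>topspace X \<noteq> {}\<close> by blast
  \<comment> \<open>Being a 0-cocycle, \<open>k\<close> takes equal values at \<open>x\<close> and
    \<open>\<tau> x\<close>. On the other hand, \<open>g + g \<circ> \<tau>\<close> is invariant
    under \<tau> while \<open>e\<close> gains 1.\<close>
  have "k (point_simplex x) = k (point_simplex (\<tau> x))"
    using k x \<tau>X[OF x] by (auto simp: cochain_unit_def singular_simplex_point_simplex)
  moreover have "k (point_simplex (\<tau> x)) = k (point_simplex x) + 1"
    using kpt[OF x] kpt[OF \<tau>X[OF x]] e\<tau>[OF x] \<tau>(2)[OF x] by (simp add: add_ac)
  ultimately show False
    by simp
qed

end

section \<open>Free actions of the group of order two\<close>

lemma double_cover_orbit_space:
  assumes "Hausdorff_space Y" and act: "free_group_action (integer_mod_group 2) Y \<psi>"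
  shows "double_cover Y (orbit_space (integer_mod_group 2) Y \<psi>) (orbit (integer_mod_group 2) \<psi>) (\<psi> 1)"
proof -
  interpret group_action "integer_mod_group 2" "topspace Y" \<psi>
    using act by (simp add: free_group_action_def continuous_group_action_def)
  have carrier: "carrier (integer_mod_group 2) = {0, 1}"
    by (auto simp: carrier_integer_mod_group)
  have zero: "\<psi> 0 y = y" if "y \<in> topspace Y" for y
    using id_eq_one that by (metis one_integer_mod_group restrict_apply')
  have one: "\<psi> 1 y \<in> topspace Y" if "y \<in> topspace Y" for y
    using element_image[of 1 y "\<psi> 1 y"] that by (simp add: carrier)
  \<comment> \<open>Composition adds group elements modulo 2, and 0 acts as the identity.\<close>
  have inv: "\<psi> 1 (\<psi> 1 y) = y" if "y \<in> topspace Y" for y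
    using composition_rule[of y 1 1] that zero by (simp add: carrier)
  have free: "\<psi> 1 y \<noteq> y" if "y \<in> topspace Y" for y
  proof
    assume "\<psi> 1 y = y"
    then have "1 \<in> stabilizer (integer_mod_group 2) \<psi> y"
      by (simp add: stabilizer_def carrier)
    then show False
      using act that by (simp add: free_group_action_def)
  qed
  have orbit: "orbit (integer_mod_group 2) \<psi> y = {y, \<psi> 1 y}" if "y \<in> topspace Y" for y
    using zero[OF that] unfolding orbit_def carrier by force
  show ?thesis
  proof
    show "quotient_map Y (orbit_space (integer_mod_group 2) Y \<psi>) (orbit (integer_mod_group 2) \<psi>)"
      unfolding orbit_space_def by (rule quotient_map_quotient_topology)
    show "continuous_map Y Y (\<psi> 1)"
      using act by (simp add: free_group_action_def continuous_group_action_def carrier)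
    show "orbit (integer_mod_group 2) \<psi> y = orbit (integer_mod_group 2) \<psi> z \<longleftrightarrow> z = y \<or> z = \<psi> 1 y"
      if "y \<in> topspace Y" "z \<in> topspace Y" for y z
      using that inv by (auto simp: orbit doubleton_eq_iff)
  qed (use assms inv free in auto)
qed

lemma no_equivariant_map_Z2:
  assumes "free_group_action (integer_mod_group 2) X \<phi>"
    and "card (carrier (cohomology_group 0 X)) = 2" and "card (carrier (cohomology_group 1 X)) = 1"
    and "Hausdorff_space Y" and "free_group_action (integer_mod_group 2) Y \<psi>"
    and "trivial_group (cohomology_group 2 (orbit_space (integer_mod_group 2) Y \<psi>))"
  shows "\<not> equivariant_map (integer_mod_group 2) X \<phi> Y \<psi> f"
proof
  assume equi: "equivariant_map (integer_mod_group 2) X \<phi> Y \<psi> f"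
  interpret X: group_action "integer_mod_group 2" "topspace X" \<phi>
    using assms(1) by (simp add: free_group_action_def continuous_group_action_def)
  interpret double_cover Y "orbit_space (integer_mod_group 2) Y \<psi>" "orbit (integer_mod_group 2) \<psi>" "\<psi> 1"
    using assms double_cover_orbit_space by blast
  have carrier: "carrier (integer_mod_group 2) = {0, 1}"
    by (auto simp: carrier_integer_mod_group)
  have "card (cocycles 0 X) = 2"
    using assms(2) by (simp only: card_cohomology_group_0)
  note H0 = cocycles_0_of_card_2[OF this]
  show False
  proof (rule no_equivariant_map[OF _ H0(2) _ H0(1)])
    show "cocycles 2 (orbit_space (integer_mod_group 2) Y \<psi>) \<subseteq>
          coboundaries 2 (orbit_space (integer_mod_group 2) Y \<psi>)"
      using assms(6) unfolding card_cohomology_group_eq_1_iff[symmetric] by (simp add: trivial_group_def)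
    show "cocycles 1 X \<subseteq> coboundaries 1 X"
      using assms(3) unfolding card_cohomology_group_eq_1_iff .
    show "continuous_map X X (\<phi> 1)"
      using assms(1) by (simp add: free_group_action_def continuous_group_action_def carrier)
    show "\<phi> 1 (\<phi> 1 x) = x" if "x \<in> topspace X" for x
      using X.composition_rule[of x 1 1] that X.id_eq_one
      by (simp add: carrier) (metis restrict_apply')
    show "continuous_map X Y f" "\<And>x. x \<in> topspace X \<Longrightarrow> f (\<phi> 1 x) = \<psi> 1 (f x)"
      using equi by (auto simp: equivariant_map_def carrier)
  qed
qed

section \<open>Complex Milnor manifolds\<close>

lemma continuous_map_complex_mult:
  fixes f g :: "'a \<Rightarrow> complex"
  assumes "continuous_map X euclidean f" "continuous_map X euclidean g"
  shows "continuous_map X euclidean (\<lambda>x. f x * g x)"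
  using assms by (simp add: continuous_map_atin tendsto_mult)

lemma continuous_map_complex_divide:
  fixes f g :: "'a \<Rightarrow> complex"
  assumes "continuous_map X euclidean f" "continuous_map X euclidean g"
    and "\<And>x. x \<in> topspace X \<Longrightarrow> g x \<noteq> 0"
  shows "continuous_map X euclidean (\<lambda>x. f x / g x)"
  using assms by (simp add: continuous_map_atin tendsto_divide)

lemma continuous_map_cnj:
  assumes "continuous_map X euclidean f"
  shows "continuous_map X euclidean (\<lambda>x. cnj (f x))"
  using assms by (simp add: continuous_map_atin tendsto_cnj)

lemma complex_line_self: "z \<in> complex_line z"
  unfolding complex_line_def by (rule CollectI, rule exI[of _ 1]) simp

lemma complex_line_scale:
  assumes "c \<noteq> 0"
  shows "complex_line (\<lambda>i. c * z i) = complex_line z"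
proof (intro subset_antisym subsetI)
  fix x assume "x \<in> complex_line (\<lambda>i. c * z i)"
  then obtain d where "d \<noteq> 0" "x = (\<lambda>i. (d * c) * z i)"
    by (auto simp: complex_line_def mult.assoc)
  then show "x \<in> complex_line z"
    using assms unfolding complex_line_def by (intro CollectI exI[of _ "d * c"]) auto
next
  fix x assume "x \<in> complex_line z"
  then obtain d where "d \<noteq> 0" "x = (\<lambda>i. d * z i)"
    by (auto simp: complex_line_def)
  then show "x \<in> complex_line (\<lambda>i. c * z i)"
    using assms unfolding complex_line_def by (intro CollectI exI[of _ "d / c"]) auto
qed

text \<open>On a line, every representative gives the same ratio, so the choice is harmless. Because
  division by zero yields 0, \<open>affine_coord i L i\<close> is 1 where the homogeneous coordinate
  \<open>i\<close> is nonzero and 0 elsewhere; testing it against 0 therefore describes the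
  chart.\<close>

definition affine_coord :: "nat \<Rightarrow> (nat \<Rightarrow> complex) set \<Rightarrow> nat \<Rightarrow> complex" where
  "affine_coord i L k = (SOME z. z \<in> L) k / (SOME z. z \<in> L) i"

lemma affine_coord_line [simp]: "affine_coord i (complex_line z) k = z k / z i"
proof -
  have "(SOME x. x \<in> complex_line z) \<in> complex_line z"
    by (rule someI[of _ z]) (rule complex_line_self)
  then show ?thesis
    by (auto simp: affine_coord_def complex_line_def)
qed

lemma complex_line_affine_coord:
  assumes "z i \<noteq> 0"
  shows "complex_line (affine_coord i (complex_line z)) = complex_line z"
proof -
  have "affine_coord i (complex_line z) = (\<lambda>k. inverse (z i) * z k)"
    by (simp add: fun_eq_iff divide_inverse mult.commute)
  then show ?thesis
    using complex_line_scale[of "inverse (z i)" z] assms by simp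
qed

abbreviation complex_nonzero_topology :: "nat \<Rightarrow> (nat \<Rightarrow> complex) topology" where
  "complex_nonzero_topology n \<equiv> subtopology (product_topology (\<lambda>_. euclidean) UNIV) (complex_nonzero n)"

lemma quotient_map_complex_line:
  "quotient_map (complex_nonzero_topology n) (complex_projective_space n) complex_line"
  unfolding complex_projective_space_def by (rule quotient_map_quotient_topology)

lemma topspace_complex_projective_space:
  "topspace (complex_projective_space n) = complex_line ` complex_nonzero n"
  by (simp add: complex_projective_space_def)

lemma openin_affine_chart:
  "openin (complex_projective_space n) {L \<in> topspace (complex_projective_space n). affine_coord i L i \<noteq> 0}"
proof -
  let ?V = "{L \<in> topspace (complex_projective_space n). affine_coord i L i \<noteq> 0}"
  have "{z \<in> topspace (complex_nonzero_topology n). complex_line z \<in> ?V} =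
        {z \<in> topspace (complex_nonzero_topology n). z i \<in> - {0}}"
    by (auto simp: topspace_complex_projective_space)
  moreover have "openin (complex_nonzero_topology n) {z \<in> topspace (complex_nonzero_topology n). complex_line z \<in> ?V}
      \<longleftrightarrow> openin (complex_projective_space n) ?V"
    by (rule quotient_map_complex_line[unfolded quotient_map_def, THEN conjunct2, rule_format]) blast
  moreover have "openin (complex_nonzero_topology n) {z \<in> topspace (complex_nonzero_topology n). z i \<in> - {0}}"
    by (rule openin_continuous_map_preimage[where Y = euclidean])
       (auto intro!: continuous_map_from_subtopology continuous_map_product_projection)
  ultimately show ?thesis
    by (simp only:)
qed

text \<open>A quotient map restricted to the preimage of an open set is again a quotient map, so
  continuity can be tested on vectors, where the coordinate is \<open>z k / z i\<close>.\<close>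

lemma continuous_affine_coord:
  "continuous_map (subtopology (complex_projective_space n) {L. affine_coord i L i \<noteq> 0}) euclidean
     (\<lambda>L. affine_coord i L k)"
proof -
  let ?V = "{L \<in> topspace (complex_projective_space n). affine_coord i L i \<noteq> 0}"
  let ?U = "{z \<in> topspace (complex_nonzero_topology n). complex_line z \<in> ?V}"
  have q: "quotient_map (subtopology (complex_nonzero_topology n) ?U)
      (subtopology (complex_projective_space n) ?V) complex_line"
    by (rule quotient_map_restriction[OF quotient_map_complex_line]) (auto simp: openin_affine_chart)
  have proj: "continuous_map (subtopology (complex_nonzero_topology n) ?U) euclidean (\<lambda>z. z k)" for k
    by (intro continuous_map_from_subtopology continuous_map_product_projection) simp
  have "continuous_map (subtopology (complex_nonzero_topology n) ?U) euclidean (\<lambda>z. z k / z i)"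
    by (intro continuous_map_complex_divide proj) auto
  then have "continuous_map (subtopology (complex_projective_space n) ?V) euclidean (\<lambda>L. affine_coord i L k)"
    unfolding continuous_compose_quotient_map_eq[OF q, symmetric] by (simp add: o_def)
  moreover have "subtopology (complex_projective_space n) ?V =
      subtopology (complex_projective_space n) {L. affine_coord i L i \<noteq> 0}"
    by (metis (no_types) Collect_conj_eq Collect_mem_eq subtopology_restrict)
  ultimately show ?thesis
    by simp
qed

lemma continuous_complex_line:
  assumes "\<And>k. continuous_map T euclidean (\<lambda>x. A x k)"
    and "\<And>x. x \<in> topspace T \<Longrightarrow> A x \<in> complex_nonzero n"
  shows "continuous_map T (complex_projective_space n) (\<lambda>x. complex_line (A x))"
proof -
  have "continuous_map T (complex_nonzero_topology n) A"
    using assms by (auto simp: continuous_map_in_subtopology continuous_map_componentwise_UNIV)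
  then have "continuous_map T (complex_projective_space n) (complex_line \<circ> A)"
    using quotient_imp_continuous_map[OF quotient_map_complex_line] continuous_map_compose by blast
  then show ?thesis
    by (simp add: o_def)
qed

section \<open>Charts of the Milnor manifold\<close>

lemma topspace_complex_Milnor:
  "topspace (complex_Milnor r s) = {(complex_line z, complex_line w) | z w.
     z \<in> complex_nonzero r \<and> w \<in> complex_nonzero s \<and> (\<Sum>i\<le>s. z i * cnj (w i)) = 0}"
  by (auto simp: complex_Milnor_def topspace_complex_projective_space)

text \<open>On the chart \<open>z\<^sub>i = w\<^sub>j = 1\<close> with \<open>i \<noteq> j\<close>, the defining equation determines \<open>z\<^sub>j\<close> from the other
  coordinates, which are free.\<close>

definition milnor_chart :: "nat \<Rightarrow> nat \<Rightarrow> nat \<Rightarrow> nat \<Rightarrow>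
    ((nat \<Rightarrow> complex) set \<times> (nat \<Rightarrow> complex) set) set" where
  "milnor_chart r s i j = {p \<in> topspace (complex_Milnor r s).
     affine_coord i (fst p) i \<noteq> 0 \<and> affine_coord j (snd p) j \<noteq> 0}"

definition solve_coord :: "nat \<Rightarrow> nat \<Rightarrow> (nat \<Rightarrow> complex) \<Rightarrow> (nat \<Rightarrow> complex) \<Rightarrow> nat \<Rightarrow> complex" where
  "solve_coord s j a b = a(j := - (\<Sum>l\<in>{..s} - {j}. a l * cnj (b l)))"

definition normalized :: "nat \<Rightarrow> nat \<Rightarrow> (nat \<Rightarrow> complex) \<Rightarrow> bool" where
  "normalized n i a \<longleftrightarrow> i \<le> n \<and> a i = 1 \<and> (\<forall>k>n. a k = 0)"

lemma normalized_in_complex_nonzero: "normalized n i a \<Longrightarrow> a \<in> complex_nonzero n"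
  by (auto simp: normalized_def complex_nonzero_def)

text \<open>As \<open>i \<noteq> j\<close>, overwriting entry \<open>j\<close> preserves the entry 1
  at \<open>i\<close>; as \<open>j \<le> s \<le> r\<close>, the entries beyond \<open>r\<close>
  remain 0.\<close>

lemma normalized_solve_coord:
  "normalized r i a \<Longrightarrow> i \<noteq> j \<Longrightarrow> j \<le> s \<Longrightarrow> s \<le> r \<Longrightarrow> normalized r i (solve_coord s j a b)"
  by (auto simp: normalized_def solve_coord_def)

lemma solve_coord_equation:
  assumes "normalized s j b"
  shows "(\<Sum>k\<le>s. solve_coord s j a b k * cnj (b k)) = 0"
proof -
  have "(\<Sum>k\<le>s. solve_coord s j a b k * cnj (b k)) =
      solve_coord s j a b j * cnj (b j) + (\<Sum>k\<in>{..s} - {j}. solve_coord s j a b k * cnj (b k))"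
    using assms by (intro sum.remove) (auto simp: normalized_def)
  also have "(\<Sum>k\<in>{..s} - {j}. solve_coord s j a b k * cnj (b k)) = (\<Sum>k\<in>{..s} - {j}. a k * cnj (b k))"
    by (intro sum.cong) (auto simp: solve_coord_def)
  finally show ?thesis
    using assms by (simp add: normalized_def solve_coord_def)
qed

lemma solve_coord_id:
  assumes "normalized s j b" "(\<Sum>k\<le>s. a k * cnj (b k)) = 0"
  shows "solve_coord s j a b = a"
proof -
  have "(\<Sum>k\<le>s. a k * cnj (b k)) = a j * cnj (b j) + (\<Sum>k\<in>{..s} - {j}. a k * cnj (b k))"
    using assms by (intro sum.remove) (auto simp: normalized_def)
  then show ?thesis
    using assms by (simp add: normalized_def solve_coord_def fun_eq_iff add_eq_0_iff2)
qed

lemma milnor_chart_point: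
  assumes "normalized r i a" "normalized s j b" "i \<noteq> j" "s \<le> r"
  shows "(complex_line (solve_coord s j a b), complex_line b) \<in> milnor_chart r s i j"
proof -
  have n: "normalized r i (solve_coord s j a b)"
    using assms by (auto intro: normalized_solve_coord simp: normalized_def[of s])
  then have "solve_coord s j a b i = 1" "b j = 1"
    using assms by (auto simp: normalized_def)
  then show ?thesis
    using solve_coord_equation[OF assms(2), of a] normalized_in_complex_nonzero[OF n]
      normalized_in_complex_nonzero[OF assms(2)]
    unfolding milnor_chart_def topspace_complex_Milnor by auto
qed

text \<open>Dividing the equation for representatives by \<open>z i * cnj (w j)\<close> gives the
  equation for the normalized coordinates, so solving it for entry \<open>j\<close> changes
  nothing.\<close>

lemma milnor_chart_coords:
  assumes "p \<in> milnor_chart r s i j"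
  defines "a \<equiv> affine_coord i (fst p)" and "b \<equiv> affine_coord j (snd p)"
  shows "normalized r i a" "normalized s j b" "p = (complex_line (solve_coord s j a b), complex_line b)"
    "solve_coord s j a b = a"
proof -
  obtain z w where p: "p = (complex_line z, complex_line w)" "z \<in> complex_nonzero r"
      "w \<in> complex_nonzero s" "(\<Sum>k\<le>s. z k * cnj (w k)) = 0"
    using assms by (auto simp: milnor_chart_def topspace_complex_Milnor)
  have nz: "z i \<noteq> 0" "w j \<noteq> 0"
    using assms(1) by (auto simp: milnor_chart_def p)
  have a: "a = (\<lambda>k. z k / z i)" and b: "b = (\<lambda>k. w k / w j)"
    by (auto simp: a_def b_def p)
  show na: "normalized r i a" and nb: "normalized s j b"
    using p nz by (auto simp: normalized_def a b complex_nonzero_def) (meson not_le)+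
  have "(\<Sum>k\<le>s. a k * cnj (b k)) = (\<Sum>k\<le>s. z k * cnj (w k)) / (z i * cnj (w j))"
    by (simp add: a b sum_divide_distrib)
  then show eq: "solve_coord s j a b = a"
    using p by (intro solve_coord_id[OF nb]) simp
  show "p = (complex_line (solve_coord s j a b), complex_line b)"
    using nz unfolding eq by (simp add: a_def b_def p complex_line_affine_coord)
qed

text \<open>The parameter space \<open>T\<close> will be the cylinder over a chart, to contract it,
  and the complex plane, to join two points.\<close>

lemma continuous_milnor_chart_point:
  assumes A: "\<And>k. continuous_map T euclidean (\<lambda>x. A x k)" "\<And>x. x \<in> topspace T \<Longrightarrow> normalized r i (A x)"
    and B: "\<And>k. continuous_map T euclidean (\<lambda>x. B x k)" "\<And>x. x \<in> topspace T \<Longrightarrow> normalized s j (B x)"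
    and "i \<noteq> j" "s \<le> r"
  shows "continuous_map T (subtopology (complex_Milnor r s) (milnor_chart r s i j))
    (\<lambda>x. (complex_line (solve_coord s j (A x) (B x)), complex_line (B x)))"
proof -
  let ?F = "\<lambda>x. (complex_line (solve_coord s j (A x) (B x)), complex_line (B x))"
  have mem: "?F x \<in> milnor_chart r s i j" if "x \<in> topspace T" for x
    using that assms by (intro milnor_chart_point) auto
  have S: "continuous_map T euclidean (\<lambda>x. solve_coord s j (A x) (B x) k)" for k
  proof (cases "k = j")
    case True
    then show ?thesis
      by (auto simp: solve_coord_def intro!: continuous_map_minus continuous_map_sum
          continuous_map_complex_mult continuous_map_cnj A B)
  next
    case False
    then show ?thesis
      by (simp add: solve_coord_def A)
  qed
  have "continuous_map T (prod_topology (complex_projective_space r) (complex_projective_space s)) ?F"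
  proof (intro continuous_map_pairedI continuous_complex_line S B)
    show "solve_coord s j (A x) (B x) \<in> complex_nonzero r" "B x \<in> complex_nonzero s" if "x \<in> topspace T" for x
      using A(2)[OF that] B(2)[OF that] assms
      by (auto intro!: normalized_in_complex_nonzero normalized_solve_coord simp: normalized_def[of s])
  qed
  moreover have "?F x \<in> topspace (complex_Milnor r s)" if "x \<in> topspace T" for x
    using mem[OF that] by (simp add: milnor_chart_def)
  then have "?F ` topspace T \<subseteq> {(complex_line z, complex_line w) | z w.
          z \<in> complex_nonzero r \<and> w \<in> complex_nonzero s \<and> (\<Sum>i\<le>s. z i * cnj (w i)) = 0}"
    unfolding topspace_complex_Milnor by blast
  ultimately show ?thesis
    using mem unfolding complex_Milnor_def continuous_map_in_subtopology by (auto simp: image_subset_iff)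
qed

lemma continuous_milnor_coords:
  "continuous_map (subtopology (complex_Milnor r s) (milnor_chart r s i j)) euclidean (\<lambda>p. affine_coord i (fst p) k)"
  "continuous_map (subtopology (complex_Milnor r s) (milnor_chart r s i j)) euclidean (\<lambda>p. affine_coord j (snd p) k)"
proof -
  let ?T = "subtopology (complex_Milnor r s) (milnor_chart r s i j)"
  have "continuous_map ?T (subtopology (complex_projective_space r) {L. affine_coord i L i \<noteq> 0}) fst"
    "continuous_map ?T (subtopology (complex_projective_space s) {L. affine_coord j L j \<noteq> 0}) snd"
    unfolding complex_Milnor_def
    by (auto simp: continuous_map_in_subtopology milnor_chart_def
        intro!: continuous_map_from_subtopology continuous_map_fst continuous_map_snd)
  then show "continuous_map ?T euclidean (\<lambda>p. affine_coord i (fst p) k)"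
    "continuous_map ?T euclidean (\<lambda>p. affine_coord j (snd p) k)"
    using continuous_map_compose[OF _ continuous_affine_coord] by (auto simp: o_def)
qed

lemma openin_milnor_chart: "openin (complex_Milnor r s) (milnor_chart r s i j)"
proof -
  let ?V = "\<lambda>n i. {L \<in> topspace (complex_projective_space n). affine_coord i L i \<noteq> 0}"
  have "openin (prod_topology (complex_projective_space r) (complex_projective_space s)) (?V r i \<times> ?V s j)"
    unfolding openin_prod_Times_iff using openin_affine_chart by blast
  moreover have "milnor_chart r s i j = (?V r i \<times> ?V s j) \<inter> topspace (complex_Milnor r s)"
    by (auto simp: milnor_chart_def topspace_complex_Milnor topspace_complex_projective_space)
  moreover have "topspace (complex_Milnor r s) = {(complex_line z, complex_line w) | z w.
          z \<in> complex_nonzero r \<and> w \<in> complex_nonzero s \<and> (\<Sum>i\<le>s. z i * cnj (w i)) = 0}"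
    by (rule topspace_complex_Milnor)
  ultimately show ?thesis
    unfolding complex_Milnor_def openin_subtopology by (metis (no_types, lifting))
qed

lemma contractible_milnor_chart:
  assumes "i \<noteq> j" "s \<le> r"
  shows "contractible_space (subtopology (complex_Milnor r s) (milnor_chart r s i j))"
proof -
  let ?T = "subtopology (complex_Milnor r s) (milnor_chart r s i j)"
  let ?P = "prod_topology (top_of_set {0..1::real}) ?T"
  \<comment> \<open>The coordinates are scaled linearly to 0 except for the normalized ones, which
    stay 1. Entry \<open>j\<close> of the first vector is solved for anew at each time, so the
    equation is preserved.\<close>
  define A where "A x k = (if k = i then 1 else (1 - complex_of_real (fst x)) * affine_coord i (fst (snd x)) k)" 
    for x :: "real \<times> _ \<times> (nat \<Rightarrow> complex) set" and k
  define B where "B x k = (if k = j then 1 else (1 - complex_of_real (fst x)) * affine_coord j (snd (snd x)) k)"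
    for x :: "real \<times> (nat \<Rightarrow> complex) set \<times> _" and k
  define F where "F x = (complex_line (solve_coord s j (A x) (B x)), complex_line (B x))" for x
  define q where "q = (complex_line (solve_coord s j (\<lambda>k. if k = i then 1 else 0) (\<lambda>k. if k = j then 1 else 0)),
     complex_line (\<lambda>k. if k = j then 1 else 0))"
  have sc: "continuous_map ?P euclidean (\<lambda>x. 1 - complex_of_real (fst x))"
  proof -
    have "continuous_map (top_of_set {0..1}) euclidean (\<lambda>t. 1 - complex_of_real t)"
      by (auto intro!: continuous_intros)
    then have "continuous_map ?P euclidean ((\<lambda>t. 1 - complex_of_real t) \<circ> fst)"
      using continuous_map_fst continuous_map_compose by blast
    then show ?thesis
      by (simp add: o_def)
  qed
  have coords: "continuous_map ?P euclidean (\<lambda>x. affine_coord i (fst (snd x)) k)"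
    "continuous_map ?P euclidean (\<lambda>x. affine_coord j (snd (snd x)) k)" for k
    using continuous_map_compose[OF continuous_map_snd continuous_milnor_coords(1)]
      continuous_map_compose[OF continuous_map_snd continuous_milnor_coords(2)]
    by (auto simp: o_def)
  have "continuous_map ?P ?T F"
    unfolding F_def
  proof (rule continuous_milnor_chart_point)
    show "continuous_map ?P euclidean (\<lambda>x. A x k)" for k
      by (cases "k = i") (auto simp: A_def intro!: continuous_map_complex_mult sc coords)
    show "continuous_map ?P euclidean (\<lambda>x. B x k)" for k
      by (cases "k = j") (auto simp: B_def intro!: continuous_map_complex_mult sc coords)
    fix x assume "x \<in> topspace ?P"
    then have "snd x \<in> milnor_chart r s i j"
      by auto
    from milnor_chart_coords(1,2)[OF this]
    show "normalized r i (A x)" "normalized s j (B x)"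
      by (auto simp: normalized_def A_def B_def)
  qed (use assms in auto)
  moreover have "F (0, p) = p" if "p \<in> topspace ?T" for p
  proof -
    have p: "p \<in> milnor_chart r s i j"
      using that by simp
    note c = milnor_chart_coords[OF p]
    have "A (0, p) = affine_coord i (fst p)" "B (0, p) = affine_coord j (snd p)"
      using c(1,2) by (auto simp: A_def B_def normalized_def fun_eq_iff)
    then show ?thesis
      unfolding F_def using c(3) by simp
  qed
  moreover have "F (1, p) = q" for p
  proof -
    have "A (1, p) = (\<lambda>k. if k = i then 1 else 0)" "B (1, p) = (\<lambda>k. if k = j then 1 else 0)"
      by (auto simp: A_def B_def)
    then show ?thesis
      by (simp only: F_def q_def)
  qed
  ultimately have "homotopic_with (\<lambda>x. True) ?T ?T id (\<lambda>x. q)"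
    by (subst homotopic_with) auto
  then show ?thesis
    unfolding contractible_space_def by blast
qed

text \<open>Two points of the first chart lie on a complex line in the coordinates \<open>z\<close> and \<open>cnj w\<close>; the
  points of that line outside the second chart are the zeros of a nonzero polynomial.\<close>

lemma path_connectedin_milnor_chart_Int:
  assumes "i \<noteq> j" "s \<le> r"
  shows "path_connectedin (complex_Milnor r s) (milnor_chart r s i j \<inter> milnor_chart r s k l)"
  unfolding path_connectedin
proof (intro conjI ballI)
  let ?M = "complex_Milnor r s" and ?I = "milnor_chart r s i j \<inter> milnor_chart r s k l"
  show "?I \<subseteq> topspace ?M"
    by (auto simp: milnor_chart_def)
  fix p q assume "p \<in> ?I" and "q \<in> ?I"
  then have pq: "p \<in> milnor_chart r s i j" "q \<in> milnor_chart r s i j"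
    "p \<in> milnor_chart r s k l" "q \<in> milnor_chart r s k l"
    by auto
  define a b where "a = affine_coord i (fst p)" and "b = affine_coord j (snd p)"
  define a' b' where "a' = affine_coord i (fst q)" and "b' = affine_coord j (snd q)"
  note p = milnor_chart_coords[OF pq(1), folded a_def b_def]
  note q = milnor_chart_coords[OF pq(2), folded a'_def b'_def]
  define A where "A t m = (1 - t) * a m + t * a' m" for t m
  \<comment> \<open>The second vector enters the equation through its conjugate. The parameter is
    conjugated here so that \<open>cnj (B t m)\<close>, and with it \<open>Z t m\<close>, is a
    polynomial in \<open>t\<close>.\<close>
  define B where "B t m = (1 - cnj t) * b m + cnj t * b' m" for t m
  define Z where "Z t = solve_coord s j (A t) (B t)" for t
  define F where "F t = (complex_line (Z t), complex_line (B t))" for t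
  have AB: "A 0 = a" "A 1 = a'" "B 0 = b" "B 1 = b'"
    by (auto simp: A_def B_def fun_eq_iff)
  have F01: "F 0 = p" "F 1 = q"
    unfolding F_def Z_def AB using p q by auto
  have nA: "normalized r i (A t)" and nB: "normalized s j (B t)" for t
    using p q by (auto simp: normalized_def A_def B_def)
  have contF: "continuous_map euclidean (subtopology ?M (milnor_chart r s i j)) F"
    unfolding F_def Z_def
    by (rule continuous_milnor_chart_point)
       (auto simp: A_def B_def nA[unfolded A_def] nB[unfolded B_def] assms intro!: continuous_intros nA nB)
  then have FM: "F t \<in> topspace ?M" for t
    by (auto simp: continuous_map_def)
  define PA where "PA m = [:a m, a' m - a m:]" for m
  define PB where "PB m = [:cnj (b m), cnj (b' m) - cnj (b m):]" for m
  have PA: "poly (PA m) t = A t m" and PB: "poly (PB m) t = cnj (B t m)" for m t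
    by (simp_all add: PA_def PB_def A_def B_def algebra_simps)
  define PZ where "PZ m = (if m = j then - (\<Sum>l\<in>{..s} - {j}. PA l * PB l) else PA m)" for m
  have PZ: "poly (PZ m) t = Z t m" for m t
    by (simp add: PZ_def Z_def solve_coord_def poly_sum PA PB)
  \<comment> \<open>All points \<open>F t\<close> lie in the first chart. Membership in the second
    one means that two coordinates are nonzero, and conjugation preserves this.\<close>
  have inI: "F t \<in> ?I \<longleftrightarrow> poly (PZ k * PB l) t \<noteq> 0" for t
  proof -
    have "F t \<in> milnor_chart r s i j"
      unfolding F_def Z_def by (rule milnor_chart_point[OF nA nB assms])
    then show ?thesis
      using FM by (auto simp: milnor_chart_def F_def PZ PB)
  qed
  let ?S = "{t. poly (PZ k * PB l) t = 0}"
  have "F 0 \<in> ?I"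
    unfolding F01 using \<open>p \<in> ?I\<close> .
  \<comment> \<open>The polynomial does not vanish at parameter 0, which belongs to
    \<open>p\<close>.\<close>
  then have "PZ k * PB l \<noteq> 0"
    unfolding inI by auto
  then have "countable ?S"
    using poly_roots_finite countable_finite by blast
  \<comment> \<open>The complex plane has real dimension two, so removing countably many points
    leaves it path connected.\<close>
  then have "path_connected (- ?S)"
    by (intro path_connected_complement_countable) simp_all
  then have "path_connectedin euclidean (- ?S)"
    by simp
  moreover have "continuous_map euclidean ?M F"
    using contF by (simp add: continuous_map_in_subtopology)
  ultimately have "path_connectedin ?M (F ` (- ?S))"
    by (rule path_connectedin_continuous_map_image[rotated])
  moreover have "0 \<in> - ?S" "1 \<in> - ?S"
    using inI[of 0] inI[of 1] F01 pq by auto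
  then have "p \<in> F ` (- ?S)" "q \<in> F ` (- ?S)"
    using F01 by (metis imageI)+
  ultimately obtain g where "pathin ?M g" "g \<in> {0..1} \<rightarrow> F ` (- ?S)" "g 0 = p" "g 1 = q"
    unfolding path_connectedin by blast
  moreover have "F ` (- ?S) \<subseteq> ?I"
    using inI by blast
  ultimately show "\<exists>g. pathin ?M g \<and> g \<in> {0..1} \<rightarrow> ?I \<and> g 0 = p \<and> g 1 = q"
    by blast
qed

section \<open>The cover by charts and the cohomology in degrees 0 and 1\<close>

definition milnor_charts :: "nat \<Rightarrow> nat \<Rightarrow> ((nat \<Rightarrow> complex) set \<times> (nat \<Rightarrow> complex) set) set set" where
  "milnor_charts r s = {milnor_chart r s i j | i j. i \<le> r \<and> j \<le> s \<and> i \<noteq> j}"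

text \<open>If no two distinct indices had nonzero entries of \<open>z\<close> and \<open>w\<close>,
  the sum would reduce to one term \<open>z j * cnj (w j)\<close> with both factors nonzero.\<close>

lemma topspace_milnor_charts: "topspace (complex_Milnor r s) = \<Union>(milnor_charts r s)"
proof (intro subset_antisym subsetI)
  fix p assume p: "p \<in> topspace (complex_Milnor r s)"
  then obtain z w where zw: "p = (complex_line z, complex_line w)" "z \<in> complex_nonzero r"
      "w \<in> complex_nonzero s" "(\<Sum>k\<le>s. z k * cnj (w k)) = 0"
    by (auto simp: topspace_complex_Milnor)
  obtain i0 j where ij: "i0 \<le> r" "z i0 \<noteq> 0" "j \<le> s" "w j \<noteq> 0"
    using zw by (auto simp: complex_nonzero_def)
  have "\<exists>i j. i \<le> r \<and> j \<le> s \<and> i \<noteq> j \<and> z i \<noteq> 0 \<and> w j \<noteq> 0"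
  proof (rule ccontr)
    assume no: "\<nexists>i j. i \<le> r \<and> j \<le> s \<and> i \<noteq> j \<and> z i \<noteq> 0 \<and> w j \<noteq> 0"
    have "(\<Sum>k\<le>s. z k * cnj (w k)) = z j * cnj (w j) + (\<Sum>k\<in>{..s} - {j}. z k * cnj (w k))"
      using ij by (intro sum.remove) auto
    moreover have "(\<Sum>k\<in>{..s} - {j}. z k * cnj (w k)) = 0"
      using no ij by (intro sum.neutral) auto
    ultimately have "z j = 0"
      using zw ij by simp
    then show False
      using no ij by metis
  qed
  then obtain i j where "i \<le> r" "j \<le> s" "i \<noteq> j" "z i \<noteq> 0" "w j \<noteq> 0"
    by blast
  moreover from this have "p \<in> milnor_chart r s i j"
    using p by (simp add: milnor_chart_def zw(1))
  ultimately show "p \<in> \<Union>(milnor_charts r s)"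
    by (auto simp: milnor_charts_def)
qed (auto simp: milnor_charts_def milnor_chart_def)

text \<open>A point with no vanishing homogeneous coordinate lies in every chart. It is the base
  point for gluing primitives and for joining charts.\<close>

lemma milnor_charts_common_point:
  assumes "1 \<le> s" "s \<le> r"
  obtains p where "p \<in> topspace (complex_Milnor r s)" "\<And>U. U \<in> milnor_charts r s \<Longrightarrow> p \<in> U"
proof -
  define z :: "nat \<Rightarrow> complex" where "z k = (if k \<le> r then 1 else 0)" for k
  \<comment> \<open>The entries are real and sum to 0, which is the equation for the all-ones vector
    \<open>z\<close>; the entry \<open>- of_nat s\<close> is nonzero because
    \<open>1 \<le> s\<close>.\<close>
  define w :: "nat \<Rightarrow> complex" where "w k = (if k = 0 then - of_nat s else if k \<le> s then 1 else 0)" for k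
  have "(\<Sum>k\<le>s. z k * cnj (w k)) = (\<Sum>k\<le>s. w k)"
    using assms by (intro sum.cong) (auto simp: z_def w_def)
  also have "\<dots> = w 0 + (\<Sum>k\<in>{..s} - {0}. w k)"
    by (intro sum.remove) auto
  also have "(\<Sum>k\<in>{..s} - {0}. w k) = (\<Sum>k\<in>{..s} - {0}. 1)"
    by (intro sum.cong) (auto simp: w_def)
  finally have "(\<Sum>k\<le>s. z k * cnj (w k)) = 0"
    by (simp add: w_def)
  moreover have "z \<in> complex_nonzero r" "w \<in> complex_nonzero s"
    using assms by (auto simp: complex_nonzero_def z_def w_def)
  ultimately have top: "(complex_line z, complex_line w) \<in> topspace (complex_Milnor r s)"
    unfolding topspace_complex_Milnor by blast
  moreover have "w k \<noteq> 0" if "k \<le> s" for k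
    using that assms by (simp add: w_def)
  ultimately show thesis
    by (intro that[of "(complex_line z, complex_line w)"]) (auto simp: milnor_charts_def milnor_chart_def z_def)
qed

lemma path_connected_complex_Milnor:
  assumes "1 \<le> s" "s \<le> r"
  shows "path_connected_space (complex_Milnor r s)"
proof -
  obtain p where "\<And>U. U \<in> milnor_charts r s \<Longrightarrow> p \<in> U"
    using milnor_charts_common_point[OF assms] by blast
  moreover have "path_connectedin (complex_Milnor r s) U" if "U \<in> milnor_charts r s" for U
  proof -
    obtain i j where "U = milnor_chart r s i j" "i \<noteq> j"
      using \<open>U \<in> milnor_charts r s\<close> by (auto simp: milnor_charts_def)
    \<comment> \<open>A chart is its intersection with itself.\<close>
    then show ?thesis
      using path_connectedin_milnor_chart_Int[of i j s r i j] assms by simp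
  qed
  ultimately have "path_connectedin (complex_Milnor r s) (\<Union>(milnor_charts r s))"
    by (intro path_connectedin_Union) auto
  then show ?thesis
    unfolding topspace_milnor_charts[symmetric] path_connectedin_topspace .
qed

lemma cocycles_1_complex_Milnor:
  assumes "1 \<le> s" "s \<le> r"
  shows "cocycles 1 (complex_Milnor r s) \<subseteq> coboundaries 1 (complex_Milnor r s)"
proof
  fix c assume c: "c \<in> cocycles 1 (complex_Milnor r s)"
  obtain p where p: "\<And>U. U \<in> milnor_charts r s \<Longrightarrow> p \<in> U"
    using milnor_charts_common_point[OF assms] by blast
  show "c \<in> coboundaries 1 (complex_Milnor r s)"
  proof (rule coboundaries_open_cover[OF c, of "milnor_charts r s" p])
    show "topspace (complex_Milnor r s) \<subseteq> \<Union>(milnor_charts r s)"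
      by (simp add: topspace_milnor_charts)
  qed (use p assms openin_milnor_chart contractible_milnor_chart path_connectedin_milnor_chart_Int
       in \<open>auto simp: milnor_charts_def\<close>)
qed

lemma card_cohomology_group_complex_Milnor:
  assumes "1 \<le> s" "s \<le> r"
  shows "card (carrier (cohomology_group 0 (complex_Milnor r s))) = 2"
    "card (carrier (cohomology_group 1 (complex_Milnor r s))) = 1"
proof -
  let ?M = "complex_Milnor r s"
  obtain p where "p \<in> topspace ?M"
    using milnor_charts_common_point[OF assms] by blast
  moreover have "cocycles 0 ?M = {\<lambda>_. 0, cochain_unit ?M}"
    using cocycle_0_path_connected[OF path_connected_complex_Milnor[OF assms]]
      zero_in_cocycles cochain_unit_in_cocycles by blast
  ultimately show "card (carrier (cohomology_group 0 ?M)) = 2"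
    using cochain_unit_neq_0[of p ?M] by (simp add: card_cohomology_group_0 eq_commute)
  show "card (carrier (cohomology_group 1 ?M)) = 1"
    using cocycles_1_complex_Milnor[OF assms] unfolding card_cohomology_group_eq_1_iff .
qed

theorem proposition7p4:
  fixes X :: "'a topology" and Y :: "'b topology"
    and \<phi> :: "int \<Rightarrow> 'a \<Rightarrow> 'a" and \<psi> :: "int \<Rightarrow> 'b \<Rightarrow> 'b"
    and r s :: nat
  assumes "1 \<le> s" and "s \<le> r"
    and "compact_space X" and "Hausdorff_space X"
    and "free_group_action (integer_mod_group 2) X \<phi>"
    and "X \<simeq>\<^sub>2 complex_Milnor r s"
    and "compact_space Y" and "Hausdorff_space Y" and "path_connected_space Y"
    and "free_group_action (integer_mod_group 2) Y \<psi>"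
    and "trivial_group (cohomology_group 2 (orbit_space (integer_mod_group 2) Y \<psi>))"
  shows "\<nexists>f. equivariant_map (integer_mod_group 2) X \<phi> Y \<psi> f"
proof
  assume "\<exists>f. equivariant_map (integer_mod_group 2) X \<phi> Y \<psi> f"
  \<comment> \<open>No map between \<open>X\<close> and the Milnor manifold is given; the orders of
    the cohomology groups are carried across instead.\<close>
  moreover have "card (carrier (cohomology_group 0 X)) = 2" "card (carrier (cohomology_group 1 X)) = 1"
    using card_cohomology_group_cong[OF assms(6)] card_cohomology_group_complex_Milnor[OF assms(1,2)]
    by metis+
  ultimately show False
    using no_equivariant_map_Z2 assms(5,8,10,11) by blast
qed

end
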